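(* Let $G$ be a connected general graph of odd order, and let $f\colon V(G)\to\mathbb{Z}^+$ be a function. Then \[ o(G-S)\le \sum_{v\in S} f(v)\qquad\text{for every nonempty set } S\subset V(G) \] if and only if, for every function $H\colon V(G)\to 2^{\mathbb{N}}$ such that $H(v)\in\{J_f(v),\,J_f^+(v)\}$ for each $v\in V(G)$, the graph $G$ either contains an $H$-factor or is $H$-critical.
   Context: A general graph is a finite graph in which multiple edges and loops are allowed. For $S\subset V(G)$, $G-S$ is the subgraph obtained by deleting $S$, and $o(G-S)$ is the number of connected components of $G-S$ having an odd number of vertices. $\mathbb{Z}^+$ denotes the positive integers, $\mathbb{N}$ the nonnegative integers, and $2^{\mathbb{N}}$ the set of subsets of $\mathbb{N}$. For a set-valued function $H\colon V(G)\to 2^{\mathbb{N}}$, an $H$-factor of $G$ is a spanning subgraph $F$ of $G$ with $\deg_F(v)\in H(v)$ for every vertex $v$. For a positive integer $n$, $J_n=\{1,3,5,\dots,n\}$ if $n$ is odd and $J_n=\{1,3,5,\dots,n-1,n\}$ if $n$ is even; $J_f(v)=J_{f(v)}$. $J_f^+(v)$ is the set of positive odd integers $m$ with $m\le f(v)+1$. For a vertex $x$ of $G$, $G^x$ denotes the graph obtained from $G$ by adding a new vertex $x'$ and a new edge $xx'$, and $H^x$ is the function on $V(G^x)$ with $H^x(x')=\{1\}$ and $H^x(v)=H(v)$ for $v\in V(G)$. The graph $G$ is $H$-critical if $G$ contains no $H$-factor and, for every vertex $x$ of $G$, the graph $G^x$ has an $H^x$-factor. *)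

theory Defs
  imports Main
begin

text \<open>
  A general graph has a set of vertices, a set of edges and a map sending each edge to its
  set of end vertices.  Parallel edges are distinct edges with equal ends; a loop is an edge
  whose set of ends is a singleton.
\<close>

record ('v, 'e) pre_graph =
  verts :: "'v set"
  edges :: "'e set"
  ends :: "'e \<Rightarrow> 'v set"

locale general_graph =
  fixes G :: "('v, 'e) pre_graph" (structure)
  assumes finite_verts: "finite (verts G)"
    and finite_edges: "finite (edges G)"
    and ends_subset: "e \<in> edges G \<Longrightarrow> ends G e \<subseteq> verts G"
    and card_ends: "e \<in> edges G \<Longrightarrow> card (ends G e) = 1 \<or> card (ends G e) = 2"

text \<open>The second summand makes every loop count twice.\<close>

definition deg :: "('v, 'e) pre_graph \<Rightarrow> 'v \<Rightarrow> nat" where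
  "deg G v = card {e \<in> edges G. v \<in> ends G e} + card {e \<in> edges G. ends G e = {v}}"

definition adj :: "('v, 'e) pre_graph \<Rightarrow> ('v \<times> 'v) set" where
  "adj G = {(u, v). \<exists>e \<in> edges G. ends G e = {u, v}}"

definition reach :: "('v, 'e) pre_graph \<Rightarrow> ('v \<times> 'v) set" where
  "reach G = {(u, v). u \<in> verts G \<and> v \<in> verts G \<and> (u, v) \<in> (adj G)\<^sup>*}"

definition connected_graph :: "('v, 'e) pre_graph \<Rightarrow> bool" where
  "connected_graph G \<longleftrightarrow>
     verts G \<noteq> {} \<and> (\<forall>u \<in> verts G. \<forall>v \<in> verts G. (u, v) \<in> reach G)"

text \<open>Connected components are represented by their vertex sets.\<close>

definition components :: "('v, 'e) pre_graph \<Rightarrow> 'v set set" where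
  "components G = verts G // reach G"

definition odd_comps :: "('v, 'e) pre_graph \<Rightarrow> nat" where
  "odd_comps G = card {C \<in> components G. odd (card C)}"

definition delete_verts :: "('v, 'e) pre_graph \<Rightarrow> 'v set \<Rightarrow> ('v, 'e) pre_graph" where
  "delete_verts G S =
     \<lparr>verts = verts G - S, edges = {e \<in> edges G. ends G e \<inter> S = {}}, ends = ends G\<rparr>"

definition spanning_subgraph :: "('v, 'e) pre_graph \<Rightarrow> ('v, 'e) pre_graph \<Rightarrow> bool" where
  "spanning_subgraph F G \<longleftrightarrow>
     verts F = verts G \<and> edges F \<subseteq> edges G \<and> (\<forall>e \<in> edges F. ends F e = ends G e)"

definition is_factor ::
    "('v, 'e) pre_graph \<Rightarrow> ('v \<Rightarrow> nat set) \<Rightarrow> ('v, 'e) pre_graph \<Rightarrow> bool" where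
  "is_factor G H F \<longleftrightarrow> spanning_subgraph F G \<and> (\<forall>v \<in> verts G. deg F v \<in> H v)"

definition has_factor :: "('v, 'e) pre_graph \<Rightarrow> ('v \<Rightarrow> nat set) \<Rightarrow> bool" where
  "has_factor G H \<longleftrightarrow> (\<exists>F. is_factor G H F)"

text \<open>
  \<open>add_pendant G x\<close> is the graph $G^x$ and \<open>extend_pendant H\<close> the function $H^x$.  The old
  vertices and edges are tagged with \<^const>\<open>Some\<close>; the new vertex $x'$ and the new edge
  $xx'$ are both \<^const>\<open>None\<close>.
\<close>

definition add_pendant ::
    "('v, 'e) pre_graph \<Rightarrow> 'v \<Rightarrow> ('v option, 'e option) pre_graph" where
  "add_pendant G x =
     \<lparr>verts = insert None (Some ` verts G),
      edges = insert None (Some ` edges G),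
      ends = (\<lambda>e. case e of None \<Rightarrow> {Some x, None} | Some e' \<Rightarrow> Some ` ends G e')\<rparr>"

definition extend_pendant :: "('v \<Rightarrow> nat set) \<Rightarrow> 'v option \<Rightarrow> nat set" where
  "extend_pendant H v = (case v of None \<Rightarrow> {1} | Some u \<Rightarrow> H u)"

definition critical :: "('v, 'e) pre_graph \<Rightarrow> ('v \<Rightarrow> nat set) \<Rightarrow> bool" where
  "critical G H \<longleftrightarrow>
     \<not> has_factor G H \<and> (\<forall>x \<in> verts G. has_factor (add_pendant G x) (extend_pendant H))"

definition J :: "nat \<Rightarrow> nat set" where
  "J n = (if odd n then {m. odd m \<and> m \<le> n} else insert n {m. odd m \<and> m \<le> n - 1})"

text \<open>\<open>J_plus (f v)\<close> is $J_f^+(v)$.\<close>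

definition J_plus :: "nat \<Rightarrow> nat set" where
  "J_plus n = {m. odd m \<and> m \<le> n + 1}"

lemma (in general_graph) equiv_reach: "equiv (verts G) (reach G)"
proof (rule equivI)
  show "reach G \<subseteq> verts G \<times> verts G"
    by (auto simp: reach_def)
  show "refl_on (verts G) (reach G)"
    by (auto simp: refl_on_def reach_def)
  have "sym (adj G)"
    by (auto simp: sym_def adj_def insert_commute)
  then have "sym ((adj G)\<^sup>*)"
    by (rule sym_rtrancl)
  then show "sym (reach G)"
    unfolding sym_def reach_def by blast
  show "trans (reach G)"
    unfolding trans_def reach_def by (blast intro: rtrancl_trans)
qed

lemma (in general_graph) general_graph_delete_verts: "general_graph (delete_verts G S)"
  using finite_verts finite_edges ends_subset card_ends
  by unfold_locales (auto simp: delete_verts_def)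

lemma (in general_graph) general_graph_add_pendant:
  assumes "x \<in> verts G"
  shows "general_graph (add_pendant G x)"
proof
  fix e assume e: "e \<in> edges (add_pendant G x)"
  show "ends (add_pendant G x) e \<subseteq> verts (add_pendant G x)"
    using e assms ends_subset by (fastforce simp: add_pendant_def)
  show "card (ends (add_pendant G x) e) = 1 \<or> card (ends (add_pendant G x) e) = 2"
  proof (cases e)
    case None
    then show ?thesis by (simp add: add_pendant_def)
  next
    case (Some d)
    then show ?thesis
      using e card_ends[of d] by (auto simp: add_pendant_def card_image)
  qed
qed (use finite_verts finite_edges in \<open>auto simp: add_pendant_def\<close>)

lemma (in general_graph) general_graph_spanning_subgraph:
  assumes "spanning_subgraph F G"
  shows "general_graph F"
proof
  show "finite (verts F)"
    using assms finite_verts by (simp add: spanning_subgraph_def)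
  show "finite (edges F)"
    using assms finite_edges by (auto simp: spanning_subgraph_def intro: finite_subset)
  fix e assume e: "e \<in> edges F"
  show "ends F e \<subseteq> verts F"
    using e assms ends_subset by (fastforce simp: spanning_subgraph_def)
  show "card (ends F e) = 1 \<or> card (ends F e) = 2"
    using e assms card_ends by (metis spanning_subgraph_def subsetD)
qed

end

theory Submission imports Defs begin

text \<open>
  Since \<open>J_plus n\<close> is \<open>J n\<close> or \<open>J (n + 1)\<close>, the functions $H$ are of the form
  $v \mapsto J_{h(v)}$ with $h \ge f$.  Call a component of $G - S$ critical if the restricted graph is
  critical.  If no nonempty $S$ leaves more than $\sum_S h$ critical components, then $G$ has a factor
  or is critical: when $S$ is a maximal set with equality, the components are critical or have a factor,
  and by Hall's theorem the critical ones can be distributed to their neighbours in $S$ so that every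
  $s$ gets exactly $h(s)$ of them.  Without a set with equality, an even value $h(v)$ can be lowered by
  one, which removes $h(v)$ from $J_{h(v)}$; once all values are odd, parity and a second extremal choice
  of $S$, through a prescribed vertex $x$, finish the argument.  Lowering caps in the same way shows that
  critical graphs have odd order, so that the critical components are among the odd ones.  Conversely,
  taking only odd degrees outside $S$ forces every odd component of $G - S$ to send an edge of the factor
  to $S$.
\<close>

subsection \<open>Hall's theorem with capacities\<close>

text \<open>The induction of Halmos and Vaughan on \<open>card K\<close>. A nonempty proper subset
  that exhausts the capacity of its neighbourhood splits the problem into two independent ones; if
  there is none, Hall's condition has slack and one element may be assigned freely.\<close>

lemma hall_capacities:
  fixes N :: "'a \<Rightarrow> 'b set" and c :: "'b \<Rightarrow> nat"
  assumes "finite K" and "\<And>x. x \<in> K \<Longrightarrow> finite (N x)"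
    and "\<And>T. T \<subseteq> K \<Longrightarrow> card T \<le> sum c (\<Union>(N ` T))"
  shows "\<exists>a. (\<forall>x\<in>K. a x \<in> N x) \<and> (\<forall>s. card {x\<in>K. a x = s} \<le> c s)"
  using assms
proof (induction "card K" arbitrary: K N c rule: less_induct)
  case less
  note fin = less.prems(1) and finN = less.prems(2) and hall = less.prems(3)
  consider "K = {}"
    | T where "T \<subset> K" "T \<noteq> {}" "card T = sum c (\<Union>(N ` T))"
    | "K \<noteq> {}" "\<And>T. T \<subset> K \<Longrightarrow> T \<noteq> {} \<Longrightarrow> card T \<noteq> sum c (\<Union>(N ` T))"
    by blast
  then show ?case
  proof cases
    case 1
    then show ?thesis by simp
  next
    case 2
    define M where "M = \<Union>(N ` T)"
    have finT: "finite T" using 2(1) fin finite_subset by blast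
    have finM: "finite M" unfolding M_def using 2(1) finN finT by blast
    have cT: "card T < card K" using 2(1) fin by (simp add: psubset_card_mono)
    have "\<exists>a. (\<forall>x\<in>T. a x \<in> N x) \<and> (\<forall>s. card {x\<in>T. a x = s} \<le> c s)"
    proof (rule less.hyps[OF cT finT])
      show "finite (N x)" if "x \<in> T" for x using that finN 2(1) by blast
      show "card Z \<le> sum c (\<Union>(N ` Z))" if "Z \<subseteq> T" for Z using that hall 2(1) by blast
    qed
    then obtain a where a: "\<And>x. x \<in> T \<Longrightarrow> a x \<in> N x" "\<And>s. card {x\<in>T. a x = s} \<le> c s"
      by blast
    have "\<exists>b. (\<forall>x\<in>K - T. b x \<in> N x - M) \<and> (\<forall>s. card {x\<in>K - T. b x = s} \<le> c s)"
    proof (rule less.hyps)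
      show "card (K - T) < card K"
        using 2 fin by (intro psubset_card_mono) auto
      show "finite (K - T)" using fin by simp
      show "finite (N x - M)" if "x \<in> K - T" for x using that finN by blast
      fix Z assume Z: "Z \<subseteq> K - T"
      have finZ: "finite Z" using Z fin finite_subset by blast
      have finNZ: "finite (\<Union>x\<in>Z. N x - M)" using Z finN finZ by blast
      \<comment> \<open>Testing the condition on \<open>Z \<union> T\<close> and cancelling the
        tight set \<open>T\<close> leaves the condition for \<open>Z\<close> outside
        \<open>M\<close>.\<close>
      have "card Z + card T = card (Z \<union> T)"
        using Z finT finZ by (subst card_Un_disjoint) auto
      also have "\<dots> \<le> sum c (\<Union>(N ` (Z \<union> T)))"
        using Z 2(1) by (intro hall) blast
      also have "\<Union>(N ` (Z \<union> T)) = (\<Union>x\<in>Z. N x - M) \<union> M"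
        unfolding M_def by blast
      also have "sum c \<dots> = sum c (\<Union>x\<in>Z. N x - M) + sum c M"
        using finNZ finM by (intro sum.union_disjoint) auto
      finally show "card Z \<le> sum c (\<Union>x\<in>Z. N x - M)"
        using 2(3) by (simp add: M_def)
    qed
    then obtain b where b: "\<And>x. x \<in> K - T \<Longrightarrow> b x \<in> N x - M"
        "\<And>s. card {x\<in>K - T. b x = s} \<le> c s"
      by blast
    define g where "g = (\<lambda>x. if x \<in> T then a x else b x)"
    \<comment> \<open>The values of \<open>a\<close> lie in \<open>M\<close> and those of
      \<open>b\<close> outside, so no capacity is shared.\<close>
    have "card {x\<in>K. g x = s} \<le> c s" for s
    proof (cases "s \<in> M")
      case True
      then have "b x \<noteq> s" if "x \<in> K - T" for x using b(1)[OF that] by blast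
      then have "{x\<in>K. g x = s} = {x\<in>T. a x = s}"
        using 2(1) by (auto simp: g_def)
      then show ?thesis using a(2) by simp
    next
      case False
      then have "{x\<in>K. g x = s} = {x\<in>K - T. b x = s}"
        using a(1) by (auto simp: g_def M_def)
      then show ?thesis using b(2) by simp
    qed
    moreover have "\<forall>x\<in>K. g x \<in> N x" using a(1) b(1) by (auto simp: g_def)
    ultimately show ?thesis by (intro exI[of _ g]) simp
  next
    case 3
    then obtain x0 where x0: "x0 \<in> K" by blast
    have "sum c (N x0) > 0" using hall[of "{x0}"] x0 by simp
    then have "\<not> (\<forall>s\<in>N x0. c s = 0)" using sum.neutral[of "N x0" c] by linarith
    then obtain s0 where s0: "s0 \<in> N x0" "c s0 > 0" by auto
    define c' where "c' = c(s0 := c s0 - 1)"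
    have "\<exists>a. (\<forall>x\<in>K - {x0}. a x \<in> N x) \<and> (\<forall>s. card {x\<in>K - {x0}. a x = s} \<le> c' s)"
    proof (rule less.hyps)
      show "card (K - {x0}) < card K" using card_Diff1_less[OF fin x0] .
      show "finite (K - {x0})" using fin by simp
      show "finite (N x)" if "x \<in> K - {x0}" for x using that finN by blast
      fix Z assume Z: "Z \<subseteq> K - {x0}"
      have finNZ: "finite (\<Union>(N ` Z))" using Z finN fin finite_subset by blast
      have c'_ge: "sum c W \<le> sum c' W + 1" if "finite W" for W
      proof (cases "s0 \<in> W")
        case True
        have "sum c' (W - {s0}) = sum c (W - {s0})"
          by (intro sum.cong) (auto simp: c'_def)
        then show ?thesis
          using sum.remove[OF that True, of c] sum.remove[OF that True, of c'] by (simp add: c'_def)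
      next
        case False
        then have "sum c' W = sum c W" by (intro sum.cong) (auto simp: c'_def)
        then show ?thesis by simp
      qed
      show "card Z \<le> sum c' (\<Union>(N ` Z))"
      proof (cases "Z = {}")
        case False
        have "Z \<subset> K" using Z x0 by blast
        \<comment> \<open>Without tight sets the inequality is strict, which pays for the unit taken
          from \<open>s0\<close>.\<close>
        then have "card Z < sum c (\<Union>(N ` Z))"
          using 3(2)[OF _ False] hall[of Z] by (simp add: le_neq_implies_less)
        then show ?thesis using c'_ge[OF finNZ] by simp
      qed simp
    qed
    then obtain a where a: "\<And>x. x \<in> K - {x0} \<Longrightarrow> a x \<in> N x"
        "\<And>s. card {x\<in>K - {x0}. a x = s} \<le> c' s"
      by blast
    define g where "g = a(x0 := s0)"
    have "card {x\<in>K. g x = s} \<le> c s" for s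
    proof (cases "s = s0")
      case True
      then have "{x\<in>K. g x = s} = insert x0 {x\<in>K - {x0}. a x = s}"
        using x0 by (auto simp: g_def)
      then show ?thesis using a(2)[of s] True s0(2) fin by (simp add: c'_def)
    next
      case False
      then have "{x\<in>K. g x = s} = {x\<in>K - {x0}. a x = s}"
        by (auto simp: g_def)
      then show ?thesis using a(2)[of s] False by (simp add: c'_def)
    qed
    moreover have "\<forall>x\<in>K. g x \<in> N x" using a(1) s0 by (auto simp: g_def)
    ultimately show ?thesis by (intro exI[of _ g]) simp
  qed
qed

text \<open>Each fibre is bounded by its capacity, and the fibre sizes add up to
  \<open>card K\<close>, the total capacity, so nothing can be left over.\<close>

lemma hall_exact:
  fixes N :: "'a \<Rightarrow> 'b set" and c :: "'b \<Rightarrow> nat"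
  assumes "finite K" and "finite S" and N: "\<And>x. x \<in> K \<Longrightarrow> N x \<subseteq> S"
    and hall: "\<And>T. T \<subseteq> K \<Longrightarrow> T \<noteq> {} \<Longrightarrow> card T \<le> sum c (\<Union>(N ` T))"
    and eq: "sum c S = card K"
  shows "\<exists>a. (\<forall>x\<in>K. a x \<in> N x) \<and> (\<forall>s\<in>S. card {x\<in>K. a x = s} = c s)"
proof -
  have "card T \<le> sum c (\<Union>(N ` T))" if "T \<subseteq> K" for T
    using hall[OF that] by (cases "T = {}") auto
  then obtain a where a: "\<And>x. x \<in> K \<Longrightarrow> a x \<in> N x" "\<And>s. card {x\<in>K. a x = s} \<le> c s"
    using hall_capacities[of K N c] assms(1,2) N finite_subset by metis
  have "(\<Sum>s\<in>S. card {x\<in>K. a x = s}) = card (\<Union>s\<in>S. {x\<in>K. a x = s})"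
    using assms(1,2) by (intro card_UN_disjoint[symmetric]) auto
  also have "(\<Union>s\<in>S. {x\<in>K. a x = s}) = K" using a(1) N by blast
  finally have "(\<Sum>s\<in>S. card {x\<in>K. a x = s}) = sum c S" using eq by simp
  then have "card {x\<in>K. a x = s} = c s" if "s \<in> S" for s
    using sum_mono_inv[of "\<lambda>s. card {x\<in>K. a x = s}" S c] a(2) that assms(2) by blast
  then show ?thesis using a(1) by (intro exI[of _ a]) simp
qed

context general_graph
begin

subsection \<open>Components of induced subgraphs\<close>

definition induced_edges :: "'v set \<Rightarrow> 'e set" where
  "induced_edges U = {e \<in> edges G. ends G e \<subseteq> U}"

definition edge_closed :: "'v set \<Rightarrow> 'v set \<Rightarrow> bool" where
  "edge_closed U C \<longleftrightarrow> (\<forall>e\<in>induced_edges U. ends G e \<inter> C \<noteq> {} \<longrightarrow> ends G e \<subseteq> C)"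

text \<open>Phrased by closed sets instead of paths, because closedness is easy to compare when
  vertices are deleted. The link to \<open>reach\<close> is made in
  \<open>reach_class_in_comps\<close>.\<close>

definition connected_set :: "'v set \<Rightarrow> bool" where
  "connected_set C \<longleftrightarrow> C \<noteq> {} \<and> (\<forall>D\<subseteq>C. D \<noteq> {} \<and> edge_closed C D \<longrightarrow> D = C)"

definition comps :: "'v set \<Rightarrow> 'v set set" where
  "comps U = {C. C \<subseteq> U \<and> connected_set C \<and> edge_closed U C}"

lemma comps_subset: "C \<in> comps U \<Longrightarrow> C \<subseteq> U"
  and comps_connected: "C \<in> comps U \<Longrightarrow> connected_set C"
  and comps_closed: "C \<in> comps U \<Longrightarrow> edge_closed U C"
  and comps_nonempty: "C \<in> comps U \<Longrightarrow> C \<noteq> {}"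
  by (auto simp: comps_def connected_set_def)

lemma finite_comps: "finite U \<Longrightarrow> finite (comps U)"
  by (rule finite_subset[of _ "Pow U"]) (auto simp: comps_def)

lemma edge_closed_mono: "edge_closed U C \<Longrightarrow> W \<subseteq> U \<Longrightarrow> edge_closed W C"
  unfolding edge_closed_def induced_edges_def by blast

lemma edge_closed_Int: "edge_closed U C \<Longrightarrow> edge_closed U D \<Longrightarrow> edge_closed U (C \<inter> D)"
  unfolding edge_closed_def by blast

lemma edge_closed_self: "edge_closed U U"
  unfolding edge_closed_def induced_edges_def by blast

text \<open>The trace of \<open>D\<close> on \<open>C\<close> is closed in \<open>C\<close>, and a
  connected set has no proper nonempty closed part.\<close>

lemma connected_set_subset_closed:
  assumes "connected_set C" "C \<subseteq> U" "edge_closed U D" "C \<inter> D \<noteq> {}"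
  shows "C \<subseteq> D"
proof -
  have "edge_closed C (C \<inter> D)"
    using assms edge_closed_mono edge_closed_Int edge_closed_self by metis
  then show ?thesis
    using assms unfolding connected_set_def by blast
qed

lemma comps_disjoint:
  assumes "C \<in> comps U" "D \<in> comps U" "C \<noteq> D"
  shows "C \<inter> D = {}"
  using assms connected_set_subset_closed[of C U D] connected_set_subset_closed[of D U C]
  by (auto simp: comps_def)

lemma comps_of_connected: "connected_set C \<Longrightarrow> comps C = {C}"
  using edge_closed_self by (auto simp: comps_def connected_set_def)

text \<open>The witness is the least closed subset of \<open>U\<close> around
  \<open>v\<close>.\<close>

lemma comps_cover:
  assumes "v \<in> U"
  shows "\<exists>C\<in>comps U. v \<in> C"
proof -
  define M where "M = \<Inter>{C. C \<subseteq> U \<and> edge_closed U C \<and> v \<in> C}"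
  have sub: "M \<subseteq> U" and v: "v \<in> M"
    using assms edge_closed_self by (auto simp: M_def)
  have least: "M \<subseteq> C" if "C \<subseteq> U" "edge_closed U C" "v \<in> C" for C
    using that by (auto simp: M_def)
  have closed: "edge_closed U M"
    unfolding edge_closed_def
  proof (intro ballI impI)
    fix e assume e: "e \<in> induced_edges U" "ends G e \<inter> M \<noteq> {}"
    show "ends G e \<subseteq> M"
      unfolding M_def
    proof (rule Inter_greatest)
      fix C assume "C \<in> {C. C \<subseteq> U \<and> edge_closed U C \<and> v \<in> C}"
      then have "M \<subseteq> C" "edge_closed U C" using least by auto
      then show "ends G e \<subseteq> C" using e unfolding edge_closed_def by blast
    qed
  qed
  have "D = M" if D: "D \<subseteq> M" "D \<noteq> {}" "edge_closed M D" for D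
  proof (rule ccontr)
    assume "D \<noteq> M"
    have cl: "edge_closed U D"
      using D closed unfolding edge_closed_def induced_edges_def by blast
    show False
    proof (cases "v \<in> D")
      case True
      then show False using least[OF _ cl] D \<open>D \<noteq> M\<close> sub by blast
    next
      case False
      \<comment> \<open>The complement of a closed part is closed too, so a part missing
        \<open>v\<close> would leave a smaller closed set around \<open>v\<close>.\<close>
      have "edge_closed U (M - D)"
        using cl closed unfolding edge_closed_def by blast
      then have "M \<subseteq> M - D" using least[of "M - D"] False v sub by blast
      then show False using D by blast
    qed
  qed
  then have "connected_set M" using v unfolding connected_set_def by blast
  then show ?thesis using sub closed v by (auto simp: comps_def)
qed

lemma Union_comps: "\<Union>(comps U) = U"
  using comps_cover comps_subset by blast

text \<open>Deleting vertices inside one component breaks up only this one, since no edge inside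
  \<open>U\<close> joins it to another.\<close>

lemma comps_Diff:
  assumes C: "C \<in> comps U" and X: "X \<subseteq> C"
  shows "comps (U - X) = (comps U - {C}) \<union> comps (C - X)"
proof
  show "comps (U - X) \<subseteq> (comps U - {C}) \<union> comps (C - X)"
  proof
    fix D assume D: "D \<in> comps (U - X)"
    show "D \<in> (comps U - {C}) \<union> comps (C - X)"
    proof (cases "D \<inter> C = {}")
      case False
      then have "D \<subseteq> C"
        using connected_set_subset_closed[of D U C] C D by (auto simp: comps_def)
      then have "D \<subseteq> C - X" using comps_subset[OF D] by blast
      then show ?thesis
        using D edge_closed_mono[of "U - X" D "C - X"] comps_subset[OF C]
        by (auto simp: comps_def)
    next
      case True
      have "edge_closed U D"
        using comps_closed[OF D] comps_closed[OF C] True X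
        unfolding edge_closed_def induced_edges_def by blast
      moreover have "D \<noteq> C" using True comps_nonempty[OF D] by blast
      ultimately show ?thesis using D by (auto simp: comps_def)
    qed
  qed
  show "(comps U - {C}) \<union> comps (C - X) \<subseteq> comps (U - X)"
  proof
    fix D assume "D \<in> (comps U - {C}) \<union> comps (C - X)"
    then show "D \<in> comps (U - X)"
    proof
      assume D: "D \<in> comps U - {C}"
      then have "D \<inter> C = {}" using comps_disjoint C by blast
      then show ?thesis
        using D X edge_closed_mono[of U D "U - X"] by (auto simp: comps_def)
    next
      assume D: "D \<in> comps (C - X)"
      have "edge_closed (U - X) D"
        using comps_closed[OF D] comps_closed[OF C] comps_subset[OF D]
        unfolding edge_closed_def induced_edges_def by blast
      then show ?thesis
        using D comps_subset[OF C] by (auto simp: comps_def)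
    qed
  qed
qed

lemma comps_Diff_disjoint:
  assumes "C \<in> comps U" "X \<subseteq> C"
  shows "(comps U - {C}) \<inter> comps (C - X) = {}"
proof -
  have "D \<inter> C = {}" if "D \<in> comps U - {C}" for D
    using that assms comps_disjoint by blast
  moreover have "D \<subseteq> C" "D \<noteq> {}" if "D \<in> comps (C - X)" for D
    using comps_subset[OF that] comps_nonempty[OF that] by auto
  ultimately show ?thesis by fastforce
qed

text \<open>Counting form of \<open>comps_Diff\<close>, used with oddness and with criticality for
  \<open>P\<close>. The conditional term accounts for the loss of \<open>C\<close>; for
  \<open>X = {}\<close> the last summand restores it.\<close>

lemma card_filter_comps_Diff:
  assumes "C \<in> comps U" "X \<subseteq> C" "finite U"
  shows "card {D \<in> comps (U - X). P D} + (if P C then 1 else 0)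
    = card {D \<in> comps U. P D} + card {D \<in> comps (C - X). P D}"
proof -
  have fin: "finite (comps U)" "finite (comps (C - X))"
    using assms comps_subset finite_comps by (meson finite_Diff finite_subset)+
  have "{D \<in> comps (U - X). P D} = {D \<in> comps U - {C}. P D} \<union> {D \<in> comps (C - X). P D}"
    using comps_Diff[OF assms(1,2)] by blast
  also have "card \<dots> = card {D \<in> comps U - {C}. P D} + card {D \<in> comps (C - X). P D}"
    using comps_Diff_disjoint[OF assms(1,2)] fin by (intro card_Un_disjoint) auto
  finally have "card {D \<in> comps (U - X). P D} =
    card {D \<in> comps U - {C}. P D} + card {D \<in> comps (C - X). P D}" .
  moreover have "card {D \<in> comps U. P D} = card {D \<in> comps U - {C}. P D} + (if P C then 1 else 0)"
  proof (cases "P C")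
    case True
    then have "{D \<in> comps U. P D} = insert C {D \<in> comps U - {C}. P D}" using assms by blast
    then show ?thesis using True fin by simp
  next
    case False
    then have "{D \<in> comps U. P D} = {D \<in> comps U - {C}. P D}" by blast
    then show ?thesis using False by simp
  qed
  ultimately show ?thesis by simp
qed

lemma card_eq_sum_comps:
  assumes "finite U"
  shows "card U = sum card (comps U)"
proof -
  have "card (\<Union>(comps U)) = sum card (comps U)"
  proof (rule card_Union_disjoint)
    show "pairwise disjnt (comps U)"
      using comps_disjoint by (fastforce simp: pairwise_def disjnt_def)
    show "finite C" if "C \<in> comps U" for C
      using that assms comps_subset finite_subset by blast
  qed
  then show ?thesis by (simp add: Union_comps)
qed

definition odd_components :: "'v set \<Rightarrow> 'v set set" where
  "odd_components U = {C \<in> comps U. odd (card C)}"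

lemma even_card_odd_components:
  assumes "finite U"
  shows "even (card (odd_components U)) \<longleftrightarrow> even (card U)"
  unfolding odd_components_def card_eq_sum_comps[OF assms] even_sum_iff[OF finite_comps[OF assms]]
  by (rule refl)

subsection \<open>Factors of induced subgraphs\<close>

definition degree_in :: "'e set \<Rightarrow> 'v \<Rightarrow> nat" where
  "degree_in F v = card {e \<in> F. v \<in> ends G e} + card {e \<in> F. ends G e = {v}}"

text \<open>The shift \<open>b\<close> counts edges leaving \<open>U\<close>: with \<open>b = (\<lambda>v. of_bool (v = x))\<close> a factorization is a factor of
  the graph with a pendant edge at \<open>x\<close>.\<close>

definition factorable :: "'v set \<Rightarrow> ('v \<Rightarrow> nat set) \<Rightarrow> ('v \<Rightarrow> nat) \<Rightarrow> bool" where
  "factorable U H b \<longleftrightarrow> (\<exists>F\<subseteq>induced_edges U. \<forall>v\<in>U. degree_in F v + b v \<in> H v)"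

definition critical_set :: "'v set \<Rightarrow> ('v \<Rightarrow> nat set) \<Rightarrow> bool" where
  "critical_set U H \<longleftrightarrow>
     \<not> factorable U H (\<lambda>_. 0) \<and> (\<forall>x\<in>U. factorable U H (\<lambda>v. of_bool (v = x)))"

lemma factorable_cong:
  assumes "\<And>v. v \<in> U \<Longrightarrow> H v = H' v" "\<And>v. v \<in> U \<Longrightarrow> b v = b' v"
  shows "factorable U H b \<longleftrightarrow> factorable U H' b'"
  using assms unfolding factorable_def by simp

lemma factorable_mono:
  assumes "factorable U H b" "\<And>v. v \<in> U \<Longrightarrow> H v \<subseteq> H' v"
  shows "factorable U H' b"
  using assms unfolding factorable_def by blast

lemma finite_induced_edges: "F \<subseteq> induced_edges U \<Longrightarrow> finite F"
  by (rule finite_subset[OF _ finite_edges]) (auto simp: induced_edges_def)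

lemma degree_in_local:
  assumes "\<And>e. v \<in> ends G e \<Longrightarrow> e \<in> F \<longleftrightarrow> e \<in> F'"
  shows "degree_in F v = degree_in F' v"
proof -
  have "{e \<in> F. v \<in> ends G e} = {e \<in> F'. v \<in> ends G e}"
    "{e \<in> F. ends G e = {v}} = {e \<in> F'. ends G e = {v}}"
    using assms by auto
  then show ?thesis by (simp add: degree_in_def)
qed

text \<open>Double counting: an edge contributes two, either through its two ends or, for a loop,
  through its single end and the extra summand.\<close>

lemma sum_degree_in_even:
  assumes F: "F \<subseteq> induced_edges U" and U: "finite U"
  shows "even (sum (degree_in F) U)"
proof -
  have finF: "finite F" using F finite_induced_edges by blast
  have "(\<Sum>v\<in>U. card {e \<in> F. v \<in> ends G e}) = (\<Sum>v\<in>U. \<Sum>e\<in>F. of_bool (v \<in> ends G e))"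
    using finF by (simp add: of_bool_def sum.If_cases Int_def)
  also have "\<dots> = (\<Sum>e\<in>F. \<Sum>v\<in>U. of_bool (v \<in> ends G e))" by (rule sum.swap)
  also have "\<dots> = (\<Sum>e\<in>F. card (ends G e))"
  proof (intro sum.cong refl)
    fix e assume "e \<in> F"
    then have "{v\<in>U. v \<in> ends G e} = ends G e" using F by (auto simp: induced_edges_def)
    then show "(\<Sum>v\<in>U. of_bool (v \<in> ends G e)) = card (ends G e)"
      using U by (simp add: of_bool_def sum.If_cases Int_def)
  qed
  finally have 1: "(\<Sum>v\<in>U. card {e \<in> F. v \<in> ends G e}) = (\<Sum>e\<in>F. card (ends G e))" .
  have "(\<Sum>v\<in>U. card {e \<in> F. ends G e = {v}}) = (\<Sum>v\<in>U. \<Sum>e\<in>F. of_bool (ends G e = {v}))"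
    using finF by (simp add: of_bool_def sum.If_cases Int_def)
  also have "\<dots> = (\<Sum>e\<in>F. \<Sum>v\<in>U. of_bool (ends G e = {v}))" by (rule sum.swap)
  also have "\<dots> = (\<Sum>e\<in>F. of_bool (card (ends G e) = 1))"
  proof (intro sum.cong refl)
    fix e assume e: "e \<in> F"
    have "card {v\<in>U. ends G e = {v}} = of_bool (card (ends G e) = 1)"
    proof (cases "card (ends G e) = 1")
      case True
      then obtain v where "ends G e = {v}" using card_1_singletonE by blast
      moreover from this have "{v\<in>U. ends G e = {v}} = {v}"
        using e F by (auto simp: induced_edges_def)
      ultimately show ?thesis by simp
    next
      case False
      then have "{v\<in>U. ends G e = {v}} = {}" by auto
      then show ?thesis using False by (simp only: card.empty of_bool_eq simp_thms)
    qed
    then show "(\<Sum>v\<in>U. of_bool (ends G e = {v})) = (of_bool (card (ends G e) = 1) :: nat)"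
      using U by (simp add: of_bool_def sum.If_cases Int_def)
  qed
  finally have "sum (degree_in F) U = (\<Sum>e\<in>F. card (ends G e) + of_bool (card (ends G e) = 1))"
    using 1 by (simp add: degree_in_def sum.distrib)
  moreover have "even (card (ends G e) + of_bool (card (ends G e) = 1))" if "e \<in> F" for e
    using card_ends[of e] that F by (auto simp: induced_edges_def)
  ultimately show ?thesis by (simp add: dvd_sum)
qed

lemma odd_degrees_even_order:
  assumes "F \<subseteq> induced_edges U" "finite U" "\<And>v. v \<in> U \<Longrightarrow> odd (degree_in F v)"
  shows "even (card U)"
proof -
  have "{v\<in>U. odd (degree_in F v)} = U" using assms(3) by blast
  then show ?thesis
    using sum_degree_in_even[OF assms(1,2)] even_sum_iff[OF assms(2), of "degree_in F"] by simp
qed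

section \<open>Counting the edges between components and a deleted set\<close>

text \<open>Each member of \<open>K\<close> picks an edge of \<open>F\<close> together with an end
  of it in \<open>S\<close>; such pairs are counted by the degrees. The choice is injective, because
  an edge with an end in \<open>S\<close> has room for only one further end and so meets at most one
  of the disjoint sets.\<close>

lemma card_le_sum_degree_in:
  assumes F: "F \<subseteq> edges G" and S: "finite S"
    and disj: "pairwise disjnt K" "\<And>C. C \<in> K \<Longrightarrow> C \<inter> S = {}"
    and meets: "\<And>C. C \<in> K \<Longrightarrow> \<exists>e\<in>F. ends G e \<inter> C \<noteq> {} \<and> ends G e \<inter> S \<noteq> {}"
  shows "card K \<le> sum (degree_in F) S"
proof -
  have finF: "finite F" using F finite_edges finite_subset by blast
  define T where "T = (SIGMA s:S. {e \<in> F. s \<in> ends G e})"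
  have "\<exists>p. p \<in> T \<and> ends G (snd p) \<inter> C \<noteq> {}" if "C \<in> K" for C
    using meets[OF that] by (fastforce simp: T_def)
  then obtain g where g: "\<And>C. C \<in> K \<Longrightarrow> g C \<in> T \<and> ends G (snd (g C)) \<inter> C \<noteq> {}"
    by metis
  have "inj_on g K"
  proof (rule inj_onI, rule ccontr)
    fix C D assume *: "C \<in> K" "D \<in> K" "g C = g D" "C \<noteq> D"
    obtain s e where se: "g C = (s, e)" by fastforce
    then have "s \<in> S" "e \<in> F" "s \<in> ends G e" using g[OF *(1)] by (auto simp: T_def)
    have "ends G e \<inter> C \<noteq> {}" "ends G e \<inter> D \<noteq> {}"
      using g[OF *(1)] g[OF *(2)] *(3) se by (metis snd_conv)+
    then obtain c d where cd: "c \<in> C" "d \<in> D" "c \<in> ends G e" "d \<in> ends G e"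
      by blast
    have "c \<noteq> d" "c \<noteq> s" "d \<noteq> s"
      using * cd disj \<open>s \<in> S\<close> by (auto simp: pairwise_def disjnt_def)
    then have "card {s, c, d} = 3" by auto
    moreover have "finite (ends G e)"
      using card_ends[of e] \<open>e \<in> F\<close> F card.infinite by fastforce
    then have "card {s, c, d} \<le> card (ends G e)"
      using cd \<open>s \<in> ends G e\<close> by (intro card_mono) auto
    ultimately show False using card_ends[of e] \<open>e \<in> F\<close> F by auto
  qed
  moreover have "g ` K \<subseteq> T" using g by blast
  moreover have "finite T" using S finF by (auto simp: T_def)
  ultimately have "card K \<le> card T" by (metis card_inj_on_le)
  also have "\<dots> = (\<Sum>s\<in>S. card {e \<in> F. s \<in> ends G e})"
    unfolding T_def using S finF by (intro card_SigmaI) auto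
  also have "\<dots> \<le> sum (degree_in F) S" by (intro sum_mono) (simp add: degree_in_def)
  finally show ?thesis .
qed

lemma degree_in_component:
  assumes "C \<in> comps (U - S)" "F \<subseteq> induced_edges U" "v \<in> C"
    and "\<not> (\<exists>e\<in>F. ends G e \<inter> C \<noteq> {} \<and> ends G e \<inter> S \<noteq> {})"
  shows "degree_in (F \<inter> induced_edges C) v = degree_in F v"
proof (rule degree_in_local)
  fix e assume v: "v \<in> ends G e"
  have "e \<in> induced_edges C" if e: "e \<in> F"
  proof -
    have "ends G e \<inter> C \<noteq> {}" using v assms(3) by blast
    moreover from this have "e \<in> induced_edges (U - S)"
      using assms(2,4) e unfolding induced_edges_def by blast
    ultimately show ?thesis
      using comps_closed[OF assms(1)] by (auto simp: edge_closed_def induced_edges_def)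
  qed
  then show "e \<in> F \<inter> induced_edges C \<longleftrightarrow> e \<in> F" by blast
qed

text \<open>If \<open>F\<close> had no edge between \<open>C\<close> and \<open>S\<close>, its
  restriction to \<open>C\<close> would keep all degrees in \<open>C\<close>, which
  \<open>need\<close> rules out. Applied to components that have no suitable factor of their
  own.\<close>

lemma card_comps_le_sum_degree_in:
  assumes F: "F \<subseteq> induced_edges U" and S: "S \<subseteq> U" "finite U" and K: "K \<subseteq> comps (U - S)"
    and need: "\<And>C F'. C \<in> K \<Longrightarrow> F' \<subseteq> induced_edges C \<Longrightarrow>
      (\<And>v. v \<in> C \<Longrightarrow> degree_in F' v = degree_in F v) \<Longrightarrow> False"
  shows "card K \<le> sum (degree_in F) S"
proof (rule card_le_sum_degree_in)
  show "F \<subseteq> edges G" using F by (auto simp: induced_edges_def)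
  show "finite S" using S finite_subset by blast
  show "pairwise disjnt K"
    using K comps_disjoint by (fastforce simp: pairwise_def disjnt_def)
  show "C \<inter> S = {}" if "C \<in> K" for C using that K comps_subset by blast
  show "\<exists>e\<in>F. ends G e \<inter> C \<noteq> {} \<and> ends G e \<inter> S \<noteq> {}" if C: "C \<in> K" for C
  proof (rule ccontr)
    assume *: "\<not> ?thesis"
    show False
      using need[OF C, of "F \<inter> induced_edges C"] degree_in_component[OF _ F _ *] C K by blast
  qed
qed

section \<open>Gluing factors of components along a deleted set\<close>

text \<open>Every \<open>C\<close> in \<open>K\<close> is joined to \<open>a C\<close> by one edge
  and completed by a factor with a pendant edge at the other end; the remaining components use
  factors of their own. No edge inside \<open>S\<close> is taken, so the degree of a vertex of
  \<open>S\<close> is the number of components assigned to it.\<close>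

lemma factorable_glue:
  assumes U: "finite U" and S: "S \<subseteq> U" and K: "K \<subseteq> comps (U - S)"
    and a: "\<And>C. C \<in> K \<Longrightarrow> a C \<in> S"
    and link: "\<And>C. C \<in> K \<Longrightarrow> \<exists>e\<in>induced_edges U. \<exists>y\<in>C. ends G e = {a C, y}"
    and inK: "\<And>C y. C \<in> K \<Longrightarrow> y \<in> C \<Longrightarrow> factorable C H (\<lambda>v. of_bool (v = y))"
    and notK: "\<And>C. C \<in> comps (U - S) \<Longrightarrow> C \<notin> K \<Longrightarrow> factorable C H (\<lambda>_. 0)"
    and b: "\<And>v. v \<notin> S \<Longrightarrow> b v = 0"
    and deg_S: "\<And>s. s \<in> S \<Longrightarrow> card {C \<in> K. a C = s} + b s \<in> H s"
  shows "factorable U H b"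
proof -
  obtain e y where ey: "\<And>C. C \<in> K \<Longrightarrow> e C \<in> induced_edges U \<and> y C \<in> C \<and> ends G (e C) = {a C, y C}"
    using link by metis
  \<comment> \<open>One statement for both kinds of components: the shift is present exactly for
    members of \<open>K\<close>, at the end \<open>y C\<close> of the linking edge.\<close>
  have "\<exists>F\<subseteq>induced_edges C. \<forall>v\<in>C. degree_in F v + of_bool (C \<in> K \<and> v = y C) \<in> H v"
    if C: "C \<in> comps (U - S)" for C
    using inK[of C "y C"] ey[of C] notK[OF C] by (cases "C \<in> K") (auto simp: factorable_def)
  then obtain \<Phi> where \<Phi>: "\<And>C. C \<in> comps (U - S) \<Longrightarrow> \<Phi> C \<subseteq> induced_edges C"
      "\<And>C v. C \<in> comps (U - S) \<Longrightarrow> v \<in> C \<Longrightarrow> degree_in (\<Phi> C) v + of_bool (C \<in> K \<and> v = y C) \<in> H v"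
    by metis
  define F where "F = (\<Union>C\<in>comps (U - S). \<Phi> C) \<union> e ` K"
  have F: "F \<subseteq> induced_edges U"
    using \<Phi>(1) ey comps_subset unfolding F_def induced_edges_def by blast
  have disj: "C = D" if "C \<in> comps (U - S)" "D \<in> comps (U - S)" "v \<in> C" "v \<in> D" for C D v
    using that comps_disjoint by blast
  have notS: "v \<notin> S" if "C \<in> comps (U - S)" "v \<in> C" for C v
    using that comps_subset by blast
  have "degree_in F v + b v \<in> H v" if v: "v \<in> U" for v
  proof (cases "v \<in> S")
    case True
    have aC: "a C = v" if "C \<in> K" "v \<in> ends G (e C)" for C
      using that ey[OF that(1)] notS[of C "y C"] K True by auto
    have not\<Phi>: "v \<notin> ends G d" if "C \<in> comps (U - S)" "d \<in> \<Phi> C" for C d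
      using that \<Phi>(1) notS True by (fastforce simp: induced_edges_def)
    have "{d \<in> F. v \<in> ends G d} = e ` {C \<in> K. a C = v}"
      using aC not\<Phi> ey by (auto simp: F_def)
    \<comment> \<open>A linking edge has exactly one end outside \<open>S\<close>, and this end
      determines its component.\<close>
    moreover have "inj_on e {C \<in> K. a C = v}"
    proof (rule inj_onI)
      fix C D assume *: "C \<in> {C \<in> K. a C = v}" "D \<in> {C \<in> K. a C = v}" "e C = e D"
      then have CD: "C \<in> comps (U - S)" "D \<in> comps (U - S)" using K by auto
      have "y C \<in> {a D, y D}" using * ey[of C] ey[of D] by auto
      then have "y C = y D" using notS[OF CD(1), of "y C"] * ey[of C] True by auto
      moreover have "y C \<in> C" "y D \<in> D" using * ey[of C] ey[of D] by auto
      ultimately show "C = D" using disj[OF CD, of "y C"] by simp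
    qed
    moreover have "ends G d \<noteq> {v}" if dF: "d \<in> F" for d
    proof
      assume d: "ends G d = {v}"
      then obtain C where C: "C \<in> K" "d = e C"
        using dF not\<Phi> by (auto simp: F_def)
      then show False using ey[OF C(1)] d notS[of C "y C"] K True by auto
    qed
    then have no_loop: "{d \<in> F. ends G d = {v}} = {}" by blast
    ultimately have "degree_in F v = card {C \<in> K. a C = v}"
      unfolding degree_in_def no_loop by (simp add: card_image)
    then show ?thesis using deg_S[OF True] by simp
  next
    case False
    then obtain C where C: "C \<in> comps (U - S)" "v \<in> C" using comps_cover v by blast
    \<comment> \<open>The linking edge leaves \<open>C\<close>, so adding it to
      \<open>\<Phi> C\<close> really raises the degree of \<open>y C\<close> by one.\<close>
    have e\<Phi>: "e C \<notin> \<Phi> C" if "C \<in> K"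
    proof
      assume "e C \<in> \<Phi> C"
      then have "a C \<in> C" using \<Phi>(1)[OF C(1)] ey[OF that] by (auto simp: induced_edges_def)
      then show False using a[OF that] notS[OF C(1)] by blast
    qed
    \<comment> \<open>At \<open>v\<close> only the factor of its own component and the linking edge
      of that component matter.\<close>
    have local: "d \<in> F \<longleftrightarrow> d \<in> \<Phi> C \<union> (if C \<in> K then {e C} else {})" if d: "v \<in> ends G d" for d
    proof
      assume "d \<in> F"
      then consider D where "D \<in> comps (U - S)" "d \<in> \<Phi> D" | D where "D \<in> K" "d = e D"
        by (auto simp: F_def)
      then show "d \<in> \<Phi> C \<union> (if C \<in> K then {e C} else {})"
      proof cases
        case 1
        then have "v \<in> D" using \<Phi>(1)[of D] d by (auto simp: induced_edges_def)
        then have "D = C" using disj 1 C by blast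
        then show ?thesis using 1 by simp
      next
        case 2
        have "v = y D" using d ey[OF 2(1)] a[OF 2(1)] False unfolding 2(2) by auto
        then have "D = C" using disj[of D C v] 2(1) C ey[OF 2(1)] K by blast
        then show ?thesis using 2 by simp
      qed
    next
      assume "d \<in> \<Phi> C \<union> (if C \<in> K then {e C} else {})"
      then show "d \<in> F" using C by (auto simp: F_def split: if_splits)
    qed
    have "degree_in F v = degree_in (\<Phi> C \<union> (if C \<in> K then {e C} else {})) v"
      using local by (rule degree_in_local)
    also have "\<dots> = degree_in (\<Phi> C) v + of_bool (C \<in> K \<and> v = y C)"
    proof (cases "C \<in> K")
      case True
      note ev = ey[OF True]
      have fin: "finite (\<Phi> C)" using \<Phi>(1)[OF C(1)] finite_induced_edges by blast
      have ne: "v \<noteq> a C" "y C \<noteq> a C" using a[OF True] False notS[OF C(1)] ev by auto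
      have "{d \<in> \<Phi> C \<union> {e C}. v \<in> ends G d} =
          (if v = y C then insert (e C) {d \<in> \<Phi> C. v \<in> ends G d} else {d \<in> \<Phi> C. v \<in> ends G d})"
        using ev ne by auto
      moreover have "{d \<in> \<Phi> C \<union> {e C}. ends G d = {v}} = {d \<in> \<Phi> C. ends G d = {v}}"
        using ev ne by auto
      ultimately show ?thesis
        using True e\<Phi>[OF True] fin by (simp add: degree_in_def)
    qed simp
    finally have "degree_in F v = degree_in (\<Phi> C) v + of_bool (C \<in> K \<and> v = y C)" .
    then show ?thesis using \<Phi>(2)[OF C] b[OF False] by simp
  qed
  then show ?thesis using F unfolding factorable_def by blast
qed

definition neighbours :: "'v set \<Rightarrow> 'v set \<Rightarrow> 'v set \<Rightarrow> 'v set" where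
  "neighbours U S C = {s \<in> S. \<exists>e\<in>induced_edges U. \<exists>y\<in>C. ends G e = {s, y}}"

text \<open>Putting back the vertices of \<open>S - M\<close> does not enlarge \<open>C\<close>: an
  edge from \<open>C\<close> to \<open>S\<close> ends in a neighbour of \<open>C\<close>, hence in
  \<open>M\<close>, and stays deleted.\<close>

lemma comps_neighbours:
  assumes C: "C \<in> comps (U - S)" and M: "neighbours U S C \<subseteq> M" "M \<subseteq> S"
  shows "C \<in> comps (U - M)"
proof -
  have "edge_closed (U - M) C"
    unfolding edge_closed_def
  proof (intro ballI impI)
    fix e assume e: "e \<in> induced_edges (U - M)" and meet: "ends G e \<inter> C \<noteq> {}"
    then obtain y where y: "y \<in> ends G e" "y \<in> C" by blast
    have eG: "e \<in> edges G" "ends G e \<subseteq> U - M" using e by (auto simp: induced_edges_def)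
    have "ends G e \<inter> S = {}"
    proof (rule ccontr)
      assume "ends G e \<inter> S \<noteq> {}"
      then obtain s where s: "s \<in> ends G e" "s \<in> S" by blast
      have "s \<noteq> y" using s y comps_subset[OF C] by blast
      have "ends G e = {s, y}"
      proof (rule ccontr)
        assume "ends G e \<noteq> {s, y}"
        then obtain z where "z \<in> ends G e" "z \<noteq> s" "z \<noteq> y" using s y by blast
        then have "card {s, y, z} = 3" "{s, y, z} \<subseteq> ends G e" using \<open>s \<noteq> y\<close> s y by auto
        moreover have "finite (ends G e)" using eG(1) card_ends[OF eG(1)] card.infinite by fastforce
        ultimately have "3 \<le> card (ends G e)" by (metis card_mono)
        then show False using card_ends[OF eG(1)] by auto
      qed
      moreover have "e \<in> induced_edges U" using eG by (auto simp: induced_edges_def)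
      ultimately have "s \<in> neighbours U S C" using s y by (auto simp: neighbours_def)
      then show False using M eG(2) s(1) by blast
    qed
    then have "e \<in> induced_edges (U - S)" using eG by (auto simp: induced_edges_def)
    then show "ends G e \<subseteq> C" using comps_closed[OF C] meet by (auto simp: edge_closed_def)
  qed
  then show ?thesis using C M by (auto simp: comps_def)
qed

text \<open>Without neighbours \<open>C\<close> would be a component even after deleting nothing,
  hence all of \<open>U\<close>.\<close>

lemma neighbours_nonempty:
  assumes "connected_set U" "S \<subseteq> U" "S \<noteq> {}" "C \<in> comps (U - S)"
  shows "neighbours U S C \<noteq> {}"
proof
  assume "neighbours U S C = {}"
  then have "C \<in> comps U" using comps_neighbours[OF assms(4), of "{}"] by simp
  then have "C = U" using comps_of_connected[OF assms(1)] by simp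
  then show False using comps_subset[OF assms(4)] assms(2,3) by blast
qed

text \<open>Hall's theorem gives each \<open>s\<close> exactly \<open>c s\<close> members of
  \<open>K\<close>. Its condition for \<open>T\<close> is \<open>hall\<close> at the set
  \<open>M\<close> of neighbours of \<open>T\<close>, since every member of \<open>T\<close> is also
  a component of \<open>U - M\<close>. The numbers \<open>c\<close> are kept apart from the caps
  because one vertex may have to receive fewer components than its cap allows.\<close>

lemma factorable_barrier:
  assumes U: "finite U" "connected_set U" and S: "S \<subseteq> U" "S \<noteq> {}" and K: "K \<subseteq> comps (U - S)"
    and tight: "sum c S = card K"
    and hall: "\<And>M. M \<subseteq> S \<Longrightarrow> M \<noteq> {} \<Longrightarrow> card (K \<inter> comps (U - M)) \<le> sum c M"
    and inK: "\<And>C y. C \<in> K \<Longrightarrow> y \<in> C \<Longrightarrow> factorable C H (\<lambda>v. of_bool (v = y))"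
    and notK: "\<And>C. C \<in> comps (U - S) \<Longrightarrow> C \<notin> K \<Longrightarrow> factorable C H (\<lambda>_. 0)"
    and b: "\<And>v. v \<notin> S \<Longrightarrow> b v = 0"
    and deg_S: "\<And>s. s \<in> S \<Longrightarrow> c s + b s \<in> H s"
  shows "factorable U H b"
proof -
  have finS: "finite S" using S U finite_subset by blast
  have finK: "finite K" using K U finite_comps finite_subset by (metis finite_Diff)
  have sub: "neighbours U S C \<subseteq> S" for C by (auto simp: neighbours_def)
  have covered: "card T \<le> sum c (\<Union>(neighbours U S ` T))" if T: "T \<subseteq> K" "T \<noteq> {}" for T
  proof -
    define M where "M = \<Union>(neighbours U S ` T)"
    have M: "M \<subseteq> S" using sub by (auto simp: M_def)
    obtain C where "C \<in> T" using T by blast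
    then have "neighbours U S C \<noteq> {}" using neighbours_nonempty U S K T by blast
    then have "M \<noteq> {}" using \<open>C \<in> T\<close> by (auto simp: M_def)
    have "D \<in> comps (U - M)" if "D \<in> T" for D
      using that T(1) K M by (intro comps_neighbours[of D U S M]) (auto simp: M_def)
    then have "T \<subseteq> K \<inter> comps (U - M)" using T by blast
    then have "card T \<le> card (K \<inter> comps (U - M))" using finK by (intro card_mono) auto
    also have "\<dots> \<le> sum c M" using hall[OF M \<open>M \<noteq> {}\<close>] .
    finally show ?thesis by (simp add: M_def)
  qed
  obtain a where a: "\<And>C. C \<in> K \<Longrightarrow> a C \<in> neighbours U S C"
      "\<And>s. s \<in> S \<Longrightarrow> card {C \<in> K. a C = s} = c s"
    using hall_exact[OF finK finS sub covered tight] by blast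
  show ?thesis
  proof (rule factorable_glue[OF U(1) S(1) K _ _ inK notK b])
    show "a C \<in> S" if "C \<in> K" for C using a(1)[OF that] sub by blast
    show "\<exists>e\<in>induced_edges U. \<exists>y\<in>C. ends G e = {a C, y}" if "C \<in> K" for C
      using a(1)[OF that] by (auto simp: neighbours_def)
    show "card {C \<in> K. a C = s} + b s \<in> H s" if "s \<in> S" for s
      using a(2)[OF that] deg_S[OF that] by simp
  qed
qed

subsection \<open>Odd caps\<close>

text \<open>Modulo two, the odd components count \<open>card (U - X)\<close> and the odd values of
  \<open>h\<close> count \<open>card X\<close>. Hence both sides of the bounds below have the same
  parity, and a strict inequality is strict by at least two.\<close>

lemma even_odd_components_sum:
  assumes "finite U" "X \<subseteq> U" "\<And>v. v \<in> X \<Longrightarrow> odd (h v)"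
  shows "even (card (odd_components (U - X)) + card U mod 2 + sum h X)"
proof -
  have finX: "finite X" using assms finite_subset by blast
  have "{v \<in> X. odd (h v)} = X" using assms by blast
  then have "even (sum h X) \<longleftrightarrow> even (card X)" using even_sum_iff[OF finX, of h] by simp
  moreover have "even (card (odd_components (U - X))) \<longleftrightarrow> even (card (U - X))"
    using assms by (intro even_card_odd_components) auto
  moreover have "card U = card (U - X) + card X"
    using assms finX by (metis card_Diff_subset card_mono le_add_diff_inverse2)
  moreover have "even (card U mod 2) \<longleftrightarrow> even (card U)" by presburger
  ultimately show ?thesis by auto
qed

lemma J_odd: "odd n \<Longrightarrow> J n = {m. odd m \<and> m \<le> n}"
  by (simp add: J_def)

lemma J_self: "n \<in> J n"
  by (simp add: J_def)

lemma J_le: "m \<in> J n \<Longrightarrow> m \<le> n"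
  by (auto simp: J_def split: if_splits)

lemma J_pred_subset: "even n \<Longrightarrow> n > 0 \<Longrightarrow> J (n - 1) \<subseteq> J n"
  by (auto simp: J_def)

text \<open>The term \<open>card U mod 2\<close> reserves one unit for the pendant edge that parity
  demands when the order is odd. A set through \<open>x\<close> with the least surplus serves as the
  barrier; induction applies inside its components.\<close>

lemma odd_caps_factorable:
  assumes "finite U" "connected_set U" "x \<in> U" "\<And>v. v \<in> U \<Longrightarrow> odd (h v)"
    and "\<And>S. S \<subseteq> U \<Longrightarrow> S \<noteq> {} \<Longrightarrow> card (odd_components (U - S)) + card U mod 2 \<le> sum h S"
  shows "factorable U (\<lambda>v. J (h v)) (\<lambda>v. of_bool (v = x \<and> odd (card U)))"
  using assms
proof (induction "card U" arbitrary: U x rule: less_induct)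
  case less
  note fin = less.prems(1) and conn = less.prems(2) and x = less.prems(3)
    and odd_h = less.prems(4) and cond = less.prems(5)
  define \<epsilon> where "\<epsilon> = card U mod 2"
  \<comment> \<open>The surplus in the bound; the natural subtraction loses nothing on nonempty
    sets, by \<open>cond\<close>.\<close>
  define m where "m = (\<lambda>S. sum h S - (card (odd_components (U - S)) + \<epsilon>))"
  have m: "sum h S = card (odd_components (U - S)) + \<epsilon> + m S" if "S \<subseteq> U" "S \<noteq> {}" for S
    using cond[OF that] by (simp add: m_def \<epsilon>_def)
  \<comment> \<open>Only sets through \<open>x\<close> compete, so that \<open>x\<close> is
    available to absorb the surplus.\<close>
  obtain S0 where S0: "S0 \<subseteq> U \<and> x \<in> S0" "\<And>T. T \<subseteq> U \<and> x \<in> T \<Longrightarrow> m S0 \<le> m T"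
    using ex_has_least_nat[of "\<lambda>S. S \<subseteq> U \<and> x \<in> S" U m] x by blast
  define \<F> where "\<F> = {S. S \<subseteq> U \<and> x \<in> S \<and> m S = m S0}"
  have "finite \<F>" by (rule finite_subset[of _ "Pow U"]) (auto simp: \<F>_def fin)
  moreover have "\<F> \<noteq> {}" using S0 by (auto simp: \<F>_def)
  \<comment> \<open>Among the minimisers a largest one is taken; then every proper superset has a
    strictly larger surplus, which is \<open>lt\<close>.\<close>
  ultimately obtain S where S: "S \<in> \<F>" "\<And>T. T \<in> \<F> \<Longrightarrow> S \<subseteq> T \<Longrightarrow> S = T"
    using finite_has_maximal[of \<F>] by blast
  have SU: "S \<subseteq> U" and xS: "x \<in> S" and mS: "m S = m S0" using S(1) by (auto simp: \<F>_def)
  have S_ne: "S \<noteq> {}" using xS by blast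
  have finS: "finite S" using SU fin finite_subset by blast
  define d where "d = m S"
  have sumS: "sum h S = card (odd_components (U - S)) + \<epsilon> + d"
    using m[OF SU S_ne] by (simp add: d_def)
  have le: "card (odd_components (U - T)) + \<epsilon> + d \<le> sum h T" if "T \<subseteq> U" "x \<in> T" for T
  proof -
    have "T \<noteq> {}" using that by blast
    then show ?thesis using m[of T] S0(2)[of T] that mS by (simp add: d_def)
  qed
  have lt: "card (odd_components (U - T)) + \<epsilon> + d < sum h T" if T: "T \<subseteq> U" "S \<subset> T" for T
  proof -
    have "x \<in> T" using T xS by blast
    moreover have "T \<notin> \<F>" using S(2)[of T] T by blast
    ultimately have "m T \<noteq> m S0" using T by (simp add: \<F>_def)
    then have "d < m T" using S0(2)[of T] T \<open>x \<in> T\<close> mS by (simp add: d_def)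
    moreover have "T \<noteq> {}" using T by blast
    ultimately show ?thesis using m[of T] T(1) by simp
  qed
  have "even (card (odd_components (U - S)) + \<epsilon> + sum h S)"
    unfolding \<epsilon>_def using even_odd_components_sum[OF fin SU] odd_h SU by blast
  then have even_d: "even d" using sumS by auto
  \<comment> \<open>The singleton of \<open>x\<close> competes as well, so the cap of
    \<open>x\<close> has room for the slack and the pendant edge.\<close>
  have hx: "d + \<epsilon> \<le> h x" using le[of "{x}"] x by simp
  \<comment> \<open>The vertex \<open>x\<close> absorbs the slack \<open>d\<close>, which is even, and the pendant edge if there is one.\<close>
  define c where "c = h(x := h x - (d + \<epsilon>))"
  have sum_c: "sum c M = (if x \<in> M then sum h M - (d + \<epsilon>) else sum h M)" if "finite M" for M
  proof -
    have rest: "sum c (M - {x}) = sum h (M - {x})" by (intro sum.cong) (auto simp: c_def)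
    show ?thesis
    proof (cases "x \<in> M")
      case True
      have "c x + (d + \<epsilon>) = h x" using hx by (simp add: c_def)
      then show ?thesis
        using sum.remove[OF that True, of c] sum.remove[OF that True, of h] rest True by simp
    next
      case False
      then show ?thesis using rest by simp
    qed
  qed
  have comp: "factorable C (\<lambda>v. J (h v)) (\<lambda>v. of_bool (v = y \<and> odd (card C)))"
    if C: "C \<in> comps (U - S)" and y: "y \<in> C" for C y
  proof (rule less.hyps)
    have CU: "C \<subseteq> U - S" using comps_subset[OF C] .
    then show "card C < card U" using fin S_ne SU by (intro psubset_card_mono) auto
    show finC: "finite C" using CU fin by (meson finite_Diff finite_subset)
    show "connected_set C" using comps_connected[OF C] .
    show "y \<in> C" by fact
    show odd_C: "odd (h v)" if "v \<in> C" for v using that CU odd_h by blast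
    fix X assume X: "X \<subseteq> C" "X \<noteq> {}"
    have finX: "finite X" using X finC finite_subset by blast
    have "U - (S \<union> X) = U - S - X" by blast
    then have "card (odd_components (U - (S \<union> X))) + (if odd (card C) then 1 else 0)
        = card (odd_components (U - S)) + card (odd_components (C - X))"
      using card_filter_comps_Diff[OF C X(1), of "\<lambda>D. odd (card D)"] fin
      by (simp add: odd_components_def)
    moreover have "sum h (S \<union> X) = sum h S + sum h X"
      using finS finX X CU by (intro sum.union_disjoint) auto
    moreover have "card (odd_components (U - (S \<union> X))) + \<epsilon> + d < sum h (S \<union> X)"
      using X CU SU by (intro lt) auto
    \<comment> \<open>The strict bound at \<open>S \<union> X\<close> minus the equality at
      \<open>S\<close>; for odd \<open>C\<close> this is one short of the goal, and parity closes
      the gap.\<close>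
    ultimately have "card (odd_components (C - X)) < sum h X + (if odd (card C) then 1 else 0)"
      using sumS by linarith
    moreover have "even (card (odd_components (C - X)) + card C mod 2 + sum h X)"
      using even_odd_components_sum[OF finC X(1)] odd_C X by blast
    moreover have "a + n mod 2 \<le> s" if "a < s + (if odd n then 1 else 0)" "even (a + n mod 2 + s)"
      for a n s :: nat
      using that by (cases "odd n"; simp add: odd_iff_mod_2_eq_one; presburger)
    ultimately show "card (odd_components (C - X)) + card C mod 2 \<le> sum h X" by blast
  qed
  show ?case
  proof (rule factorable_barrier[OF fin conn SU S_ne, where K = "odd_components (U - S)" and c = c])
    show "odd_components (U - S) \<subseteq> comps (U - S)" by (auto simp: odd_components_def)
    show "sum c S = card (odd_components (U - S))" using sum_c[OF finS] xS sumS by simp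
    show "factorable C (\<lambda>v. J (h v)) (\<lambda>v. of_bool (v = y))"
      if "C \<in> odd_components (U - S)" "y \<in> C" for C y
      using comp[of C y] that by (simp add: odd_components_def)
    show "factorable C (\<lambda>v. J (h v)) (\<lambda>_. 0)"
      if C: "C \<in> comps (U - S)" "C \<notin> odd_components (U - S)" for C
    proof -
      obtain y where "y \<in> C" using comps_nonempty[OF C(1)] by blast
      then show ?thesis using comp[OF C(1)] C by (simp add: odd_components_def)
    qed
    show "of_bool (v = x \<and> odd (card U)) = (0 :: nat)" if "v \<notin> S" for v
      using that xS by auto
    show "c s + of_bool (s = x \<and> odd (card U)) \<in> J (h s)" if s: "s \<in> S" for s
    proof (cases "s = x")
      case True
      have "c x + of_bool (odd (card U)) = h x - d"
        using hx by (auto simp: c_def \<epsilon>_def odd_iff_mod_2_eq_one)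
      \<comment> \<open>Evenness of the slack keeps the final degree of \<open>x\<close> odd, hence
        in \<open>J (h x)\<close>.\<close>
      moreover have "odd (h x - d)" using even_d odd_h[OF x] hx by auto
      ultimately show ?thesis using True odd_h[OF x] by (simp add: J_odd)
    next
      case False
      then show ?thesis by (simp add: c_def J_self)
    qed
    fix M assume M: "M \<subseteq> S" "M \<noteq> {}"
    have finM: "finite M" and MU: "M \<subseteq> U" using M SU finS finite_subset by blast+
    have "card (odd_components (U - S) \<inter> comps (U - M)) \<le> card (odd_components (U - M))"
      using fin finite_comps[of "U - M"] by (intro card_mono) (auto simp: odd_components_def)
    \<comment> \<open>If \<open>x\<close> lies in \<open>M\<close>, minimality of the surplus pays
      for the reduced value at \<open>x\<close>; otherwise \<open>c\<close> agrees with
      \<open>h\<close> on \<open>M\<close>.\<close>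
    also have "\<dots> \<le> sum c M"
    proof (cases "x \<in> M")
      case True
      then show ?thesis using le[OF MU True] sum_c[OF finM] by simp
    next
      case False
      then show ?thesis using cond[OF MU M(2)] sum_c[OF finM] by simp
    qed
    finally show "card (odd_components (U - S) \<inter> comps (U - M)) \<le> sum c M" .
  qed
qed

subsection \<open>Critical components\<close>

definition critical_comps :: "'v set \<Rightarrow> ('v \<Rightarrow> nat set) \<Rightarrow> 'v set set" where
  "critical_comps U H = {C \<in> comps U. critical_set C H}"

lemma critical_set_cong:
  assumes "\<And>v. v \<in> U \<Longrightarrow> H v = H' v"
  shows "critical_set U H \<longleftrightarrow> critical_set U H'"
proof -
  have "factorable U H b \<longleftrightarrow> factorable U H' b" for b
    using assms by (intro factorable_cong) auto
  then show ?thesis by (simp add: critical_set_def)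
qed

text \<open>For \<open>v\<close> in \<open>S\<close> the sum drops by one and the components do not
  see the change; for \<open>v\<close> outside \<open>S\<close> the sum is unchanged and only the
  component of \<open>v\<close> can become critical. Either way a strict bound survives as a weak
  one.\<close>

lemma critical_comps_lower_cap:
  assumes fin: "finite U" and v: "v \<in> U" "h v > 0"
    and S: "S \<subseteq> U" "card (critical_comps (U - S) (\<lambda>u. J (h u))) < sum h S"
  shows "card (critical_comps (U - S) (\<lambda>u. J ((h(v := h v - 1)) u))) \<le> sum (h(v := h v - 1)) S"
proof -
  define h' where "h' = h(v := h v - 1)"
  define Q where "Q = critical_comps (U - S) (\<lambda>u. J (h u))"
  define Q' where "Q' = critical_comps (U - S) (\<lambda>u. J (h' u))"
  have finS: "finite S" using S fin finite_subset by blast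
  have finQ: "finite Q" "finite Q'"
    using fin finite_comps[of "U - S"] by (auto simp: Q_def Q'_def critical_comps_def)
  have same: "C \<in> Q" if "C \<in> Q'" "v \<notin> C" for C
  proof -
    have "critical_set C (\<lambda>u. J (h' u)) \<longleftrightarrow> critical_set C (\<lambda>u. J (h u))"
      using that by (intro critical_set_cong) (auto simp: h'_def)
    then show ?thesis using that by (simp add: Q_def Q'_def critical_comps_def)
  qed
  have sum_rest: "sum h' (S - {v}) = sum h (S - {v})"
    by (intro sum.cong) (auto simp: h'_def)
  have "card Q' \<le> sum h' S"
  proof (cases "v \<in> S")
    case True
    then have "v \<notin> C" if "C \<in> Q'" for C
      using that comps_subset by (fastforce simp: Q'_def critical_comps_def)
    then have "Q' \<subseteq> Q" using same by blast
    then have "card Q' \<le> card Q" using finQ by (intro card_mono)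
    moreover have "sum h' S + 1 = sum h S"
      using sum.remove[OF finS True, of h] sum.remove[OF finS True, of h'] sum_rest v
      by (simp add: h'_def)
    ultimately show ?thesis using S by (simp add: Q_def)
  next
    case False
    then obtain C0 where C0: "C0 \<in> comps (U - S)" "v \<in> C0" using comps_cover[of v "U - S"] v by blast
    have "C \<in> insert C0 Q" if C: "C \<in> Q'" for C
    proof (cases "v \<in> C")
      case True
      then have "C = C0"
        using C C0 comps_disjoint[of C "U - S" C0] by (auto simp: Q'_def critical_comps_def)
      then show ?thesis by simp
    qed (use same[OF C] in blast)
    then have "card Q' \<le> card (insert C0 Q)" using finQ by (intro card_mono) auto
    also have "\<dots> \<le> Suc (card Q)" using finQ by (simp add: card_insert_if)
    also have "\<dots> \<le> sum h S" using S by (simp add: Q_def)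
    also have "sum h S = sum h' S" using sum_rest False by simp
    finally show ?thesis .
  qed
  then show ?thesis by (simp add: Q'_def h'_def)
qed

lemma lower_cap_subset:
  assumes "even (h v)" "h v > 0"
  shows "J ((h(v := h v - 1)) u) \<subseteq> J (h u)"
  using J_pred_subset[of "h v"] assms by simp

text \<open>The measure that decreases in the inductions that lower even caps.\<close>

lemma card_even_caps_lower:
  fixes h :: "'v \<Rightarrow> nat"
  assumes "finite U" "v \<in> U" "even (h v)" "h v > 0"
  shows "card {u \<in> U. even ((h(v := h v - 1)) u)} < card {u \<in> U. even (h u)}"
proof (rule psubset_card_mono)
  have "odd (h v - 1)" using assms by simp
  then show "{u \<in> U. even ((h(v := h v - 1)) u)} \<subset> {u \<in> U. even (h u)}"
    using assms by (auto split: if_splits)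
qed (use assms in simp)

text \<open>For odd order, parity excludes equality in the bound, and this provides the unit for the
  pendant edge. A factor without pendant edge would have odd degrees on an odd number of
  vertices.\<close>

lemma odd_caps_critical:
  assumes "finite U" "connected_set U" "odd (card U)" "\<And>v. v \<in> U \<Longrightarrow> odd (h v)"
    and "\<And>S. S \<subseteq> U \<Longrightarrow> S \<noteq> {} \<Longrightarrow> card (odd_components (U - S)) \<le> sum h S"
  shows "critical_set U (\<lambda>v. J (h v))"
proof -
  have "card (odd_components (U - S)) + card U mod 2 \<le> sum h S" if "S \<subseteq> U" "S \<noteq> {}" for S
  proof -
    have "even (card (odd_components (U - S)) + card U mod 2 + sum h S)"
      using even_odd_components_sum[OF assms(1) that(1)] assms(4) that(1) by blast
    then have "card (odd_components (U - S)) \<noteq> sum h S"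
      using assms(3) by (auto simp: odd_iff_mod_2_eq_one)
    then show ?thesis using assms(5)[OF that] assms(3) by (simp add: odd_iff_mod_2_eq_one)
  qed
  then have "factorable U (\<lambda>v. J (h v)) (\<lambda>v. of_bool (v = x))" if "x \<in> U" for x
    using odd_caps_factorable[OF assms(1,2) that assms(4)] assms(3) by simp
  moreover have "\<not> factorable U (\<lambda>v. J (h v)) (\<lambda>_. 0)"
  proof
    assume "factorable U (\<lambda>v. J (h v)) (\<lambda>_. 0)"
    then obtain F where "F \<subseteq> induced_edges U" "\<And>v. v \<in> U \<Longrightarrow> degree_in F v \<in> J (h v)"
      by (auto simp: factorable_def)
    then have "even (card U)"
      using assms(4) by (intro odd_degrees_even_order[of F U, OF _ assms(1)]) (auto simp: J_odd)
    then show False using assms(3) by simp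
  qed
  ultimately show ?thesis by (simp add: critical_set_def)
qed

text \<open>The induction measure adds the order and the number of even caps: passing to a component
  lowers the former without raising the latter, and lowering an even cap lowers the latter.\<close>

lemma critical_comps_bound_imp_factorable_or_critical:
  assumes "finite U" "connected_set U" "\<And>v. v \<in> U \<Longrightarrow> h v > 0"
    and "\<And>S. S \<subseteq> U \<Longrightarrow> S \<noteq> {} \<Longrightarrow> card (critical_comps (U - S) (\<lambda>v. J (h v))) \<le> sum h S"
  shows "factorable U (\<lambda>v. J (h v)) (\<lambda>_. 0) \<or> critical_set U (\<lambda>v. J (h v))"
  using assms
proof (induction "card U + card {v \<in> U. even (h v)}" arbitrary: U h rule: less_induct)
  case less
  note fin = less.prems(1) and conn = less.prems(2) and pos = less.prems(3) and cond = less.prems(4)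
  let ?H = "\<lambda>v. J (h v)"
  have finF: "finite {S. S \<subseteq> U \<and> P S}" for P
    by (rule finite_subset[of _ "Pow U"]) (auto simp: fin)
  consider (tight) "\<exists>S\<subseteq>U. S \<noteq> {} \<and> card (critical_comps (U - S) ?H) = sum h S"
    | (lower) v where "v \<in> U" "even (h v)"
        "\<And>S. S \<subseteq> U \<Longrightarrow> S \<noteq> {} \<Longrightarrow> card (critical_comps (U - S) ?H) < sum h S"
    | (odd) "\<And>v. v \<in> U \<Longrightarrow> odd (h v)"
        "\<And>S. S \<subseteq> U \<Longrightarrow> S \<noteq> {} \<Longrightarrow> card (critical_comps (U - S) ?H) < sum h S"
    using cond le_neq_implies_less by metis
  then show ?case
  proof cases
    case tight
    define \<F> where "\<F> = {S. S \<subseteq> U \<and> S \<noteq> {} \<and> card (critical_comps (U - S) ?H) = sum h S}"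
    have "finite \<F>" "\<F> \<noteq> {}" using tight finF by (auto simp: \<F>_def)
    then obtain S where S: "S \<in> \<F>" "\<And>T. T \<in> \<F> \<Longrightarrow> S \<subseteq> T \<Longrightarrow> S = T"
      using finite_has_maximal[of \<F>] by blast
    have SU: "S \<subseteq> U" "S \<noteq> {}" "card (critical_comps (U - S) ?H) = sum h S"
      using S(1) by (auto simp: \<F>_def)
    have finS: "finite S" using SU fin finite_subset by blast
    have "factorable U ?H (\<lambda>_. 0)"
    proof (rule factorable_barrier[OF fin conn SU(1,2), where K = "critical_comps (U - S) ?H" and c = h])
      show "critical_comps (U - S) ?H \<subseteq> comps (U - S)" by (auto simp: critical_comps_def)
      show "sum h S = card (critical_comps (U - S) ?H)" using SU by simp
      show "factorable C ?H (\<lambda>v. of_bool (v = y))" if "C \<in> critical_comps (U - S) ?H" "y \<in> C" for C y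
        using that by (simp add: critical_comps_def critical_set_def)
      show "h s + 0 \<in> J (h s)" for s by (simp add: J_self)
      show "card (critical_comps (U - S) ?H \<inter> comps (U - M)) \<le> sum h M"
        if M: "M \<subseteq> S" "M \<noteq> {}" for M
      proof -
        have "card (critical_comps (U - S) ?H \<inter> comps (U - M)) \<le> card (critical_comps (U - M) ?H)"
          using fin finite_comps[of "U - M"] by (intro card_mono) (auto simp: critical_comps_def)
        also have "\<dots> \<le> sum h M" using M SU by (intro cond) auto
        finally show ?thesis .
      qed
      fix C assume C: "C \<in> comps (U - S)" "C \<notin> critical_comps (U - S) ?H"
      then have notcrit: "\<not> critical_set C ?H" by (simp add: critical_comps_def)
      have CU: "C \<subseteq> U - S" using comps_subset[OF C(1)] .
      have finC: "finite C" using CU fin by (meson finite_Diff finite_subset)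
      have "factorable C ?H (\<lambda>_. 0) \<or> critical_set C ?H"
      proof (rule less.hyps)
        have "card C < card U" using CU fin SU by (intro psubset_card_mono) auto
        moreover have "card {v \<in> C. even (h v)} \<le> card {v \<in> U. even (h v)}"
          using fin CU by (intro card_mono) auto
        ultimately show "card C + card {v \<in> C. even (h v)} < card U + card {v \<in> U. even (h v)}"
          by linarith
        show "finite C" "connected_set C" using finC comps_connected[OF C(1)] by auto
        show "h v > 0" if "v \<in> C" for v using that CU pos by blast
        fix X assume X: "X \<subseteq> C" "X \<noteq> {}"
        have finX: "finite X" using X finC finite_subset by blast
        have T: "S \<union> X \<subseteq> U" "S \<union> X \<noteq> {}" "S \<union> X \<noteq> S" using X CU SU by auto
        have "S \<union> X \<notin> \<F>" using S(2)[of "S \<union> X"] T(3) by blast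
        then have "card (critical_comps (U - (S \<union> X)) ?H) \<noteq> sum h (S \<union> X)"
          using T(1,2) unfolding \<F>_def by blast
        then have "card (critical_comps (U - (S \<union> X)) ?H) < sum h (S \<union> X)"
          using cond[OF T(1,2)] by linarith
        moreover have "sum h (S \<union> X) = sum h S + sum h X"
          using finS finX X CU by (intro sum.union_disjoint) auto
        \<comment> \<open>As \<open>C\<close> is not critical, breaking it up loses no critical
          component; so the bound at \<open>S \<union> X\<close> minus the equality at
          \<open>S\<close> is the bound inside \<open>C\<close>.\<close>
        moreover have "U - (S \<union> X) = U - S - X" by blast
        then have "card (critical_comps (U - (S \<union> X)) ?H)
            = card (critical_comps (U - S) ?H) + card (critical_comps (C - X) ?H)"
          using card_filter_comps_Diff[OF C(1) X(1), of "\<lambda>D. critical_set D ?H"] fin notcrit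
          by (simp add: critical_comps_def)
        ultimately show "card (critical_comps (C - X) ?H) \<le> sum h X" using SU by linarith
      qed
      then show "factorable C ?H (\<lambda>_. 0)" using notcrit by blast
    qed auto
    then show ?thesis ..
  next
    case lower
    \<comment> \<open>The strict bounds of this case become weak ones for \<open>h'\<close>. Factors
      for \<open>h'\<close>, with or without a pendant edge, are also factors for
      \<open>h\<close>.\<close>
    define h' where "h' = h(v := h v - 1)"
    have hv: "h v > 0" using pos lower(1) .
    have sub: "J (h' u) \<subseteq> J (h u)" for u
      using lower_cap_subset[of h v, OF lower(2) hv] by (simp only: h'_def)
    have "factorable U (\<lambda>u. J (h' u)) (\<lambda>_. 0) \<or> critical_set U (\<lambda>u. J (h' u))"
    proof (rule less.hyps)
      show "card U + card {u \<in> U. even (h' u)} < card U + card {u \<in> U. even (h u)}"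
        using card_even_caps_lower[where h = h, OF fin lower(1,2) hv] by (simp add: h'_def)
      show "h' u > 0" if "u \<in> U" for u
        using pos[OF that] lower(2) by (cases "u = v") (auto simp: h'_def elim!: evenE)
      show "card (critical_comps (U - S) (\<lambda>u. J (h' u))) \<le> sum h' S" if "S \<subseteq> U" "S \<noteq> {}" for S
        unfolding h'_def using critical_comps_lower_cap[OF fin lower(1) hv that(1) lower(3)[OF that]] .
    qed (use fin conn in auto)
    moreover have "factorable U ?H b" if "factorable U (\<lambda>u. J (h' u)) b" for b
      using that sub by (rule factorable_mono)
    ultimately show ?thesis by (auto simp: critical_set_def)
  next
    case odd
    \<comment> \<open>The strict bound is given for critical components only. At a largest set
      \<open>R\<close> violating it for odd components, each odd component turns out to be critical
      by \<open>odd_caps_critical\<close>, so the given bound fails at \<open>R\<close>.\<close>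
    have strict: "card (odd_components (U - S)) < sum h S" if "S \<subseteq> U" "S \<noteq> {}" for S
    proof (rule ccontr)
      assume "\<not> card (odd_components (U - S)) < sum h S"
      define \<F> where "\<F> = {S. S \<subseteq> U \<and> S \<noteq> {} \<and> sum h S \<le> card (odd_components (U - S))}"
      have "finite \<F>" using finF by (auto simp: \<F>_def)
      moreover have "S \<in> \<F>" using that \<open>\<not> _ < _\<close> by (simp add: \<F>_def)
      ultimately obtain R where R: "R \<in> \<F>" "\<And>T. T \<in> \<F> \<Longrightarrow> R \<subseteq> T \<Longrightarrow> R = T"
        using finite_has_maximal[of \<F>] by blast
      have RU: "R \<subseteq> U" "R \<noteq> {}" "sum h R \<le> card (odd_components (U - R))"
        using R(1) by (auto simp: \<F>_def)
      have finR: "finite R" using RU fin finite_subset by blast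
      have "critical_set C ?H" if "C \<in> odd_components (U - R)" for C
      proof (rule odd_caps_critical)
        have C: "C \<in> comps (U - R)" "odd (card C)" using that by (auto simp: odd_components_def)
        have CU: "C \<subseteq> U - R" using comps_subset[OF C(1)] .
        show finC: "finite C" using CU fin by (meson finite_Diff finite_subset)
        show "connected_set C" "odd (card C)" using comps_connected[OF C(1)] C by auto
        show "odd (h v)" if "v \<in> C" for v using that CU odd(1) by blast
        fix X assume X: "X \<subseteq> C" "X \<noteq> {}"
        have finX: "finite X" using X finC finite_subset by blast
        have T: "R \<union> X \<subseteq> U" "R \<union> X \<noteq> {}" "R \<union> X \<noteq> R" using X CU RU by auto
        have "R \<union> X \<notin> \<F>" using R(2)[of "R \<union> X"] T(3) by blast
        then have "\<not> sum h (R \<union> X) \<le> card (odd_components (U - (R \<union> X)))"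
          using T(1,2) unfolding \<F>_def by blast
        then have "card (odd_components (U - (R \<union> X))) < sum h (R \<union> X)"
          by simp
        moreover have "sum h (R \<union> X) = sum h R + sum h X"
          using finR finX X CU by (intro sum.union_disjoint) auto
        moreover have "U - (R \<union> X) = U - R - X" by blast
        then have "card (odd_components (U - (R \<union> X))) + 1
            = card (odd_components (U - R)) + card (odd_components (C - X))"
          using card_filter_comps_Diff[OF C(1) X(1), of "\<lambda>D. odd (card D)"] fin C(2)
          by (simp add: odd_components_def)
        ultimately show "card (odd_components (C - X)) \<le> sum h X" using RU(3) by linarith
      qed
      then have "odd_components (U - R) \<subseteq> critical_comps (U - R) ?H"
        by (auto simp: odd_components_def critical_comps_def)
      then have "card (odd_components (U - R)) \<le> card (critical_comps (U - R) ?H)"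
        using fin finite_comps[of "U - R"] by (intro card_mono) (auto simp: critical_comps_def)
      then show False using odd(2)[OF RU(1,2)] RU(3) by linarith
    qed
    show ?thesis
    proof (cases "odd (card U)")
      case True
      then have "critical_set U ?H"
        using strict by (intro odd_caps_critical[OF fin conn _ odd(1)] less_imp_le)
      then show ?thesis ..
    next
      case False
      obtain x where x: "x \<in> U" using conn by (auto simp: connected_set_def)
      have "factorable U ?H (\<lambda>v. of_bool (v = x \<and> odd (card U)))"
        using strict False
        by (intro odd_caps_factorable[OF fin conn x odd(1)])
          (simp_all add: even_iff_mod_2_eq_zero less_imp_le)
      then show ?thesis using False by simp
    qed
  qed
qed

section \<open>The order of critical sets\<close>

text \<open>Take a factor with the pendant edge at some \<open>x\<close> in \<open>S\<close>.
  Critical components have no factor of their own, so each receives an edge from \<open>S\<close>;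
  the pendant edge uses up one more unit of degree at \<open>x\<close>, hence strictness.\<close>

lemma critical_set_imp_critical_comps_less:
  assumes crit: "critical_set U (\<lambda>v. J (h v))" and U: "finite U" and S: "S \<subseteq> U" "S \<noteq> {}"
  shows "card (critical_comps (U - S) (\<lambda>v. J (h v))) < sum h S"
proof -
  obtain x where x: "x \<in> S" using S by blast
  have finS: "finite S" using S U finite_subset by blast
  have "factorable U (\<lambda>v. J (h v)) (\<lambda>v. of_bool (v = x))"
    using crit x S by (auto simp: critical_set_def)
  then obtain F where F: "F \<subseteq> induced_edges U"
      "\<And>v. v \<in> U \<Longrightarrow> degree_in F v + of_bool (v = x) \<in> J (h v)"
    by (auto simp: factorable_def)
  have "card (critical_comps (U - S) (\<lambda>v. J (h v))) \<le> sum (degree_in F) S"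
  proof (rule card_comps_le_sum_degree_in[OF F(1) S(1) U])
    show "critical_comps (U - S) (\<lambda>v. J (h v)) \<subseteq> comps (U - S)" by (auto simp: critical_comps_def)
    fix C F' assume C: "C \<in> critical_comps (U - S) (\<lambda>v. J (h v))"
      and F': "F' \<subseteq> induced_edges C" "\<And>v. v \<in> C \<Longrightarrow> degree_in F' v = degree_in F v"
    have "C \<subseteq> U - S" using C comps_subset unfolding critical_comps_def by blast
    have "degree_in F' v \<in> J (h v)" if "v \<in> C" for v
    proof -
      have "v \<in> U" "v \<noteq> x" using that x \<open>C \<subseteq> U - S\<close> by auto
      then show ?thesis using F(2)[of v] F'(2)[OF that] by simp
    qed
    then have "factorable C (\<lambda>v. J (h v)) (\<lambda>_. 0)" using F'(1) by (auto simp: factorable_def)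
    then show False using C by (simp add: critical_comps_def critical_set_def)
  qed
  also have "\<dots> < (\<Sum>v\<in>S. degree_in F v + of_bool (v = x))"
    using x finS by (intro sum_strict_mono_ex1) auto
  also have "\<dots> \<le> sum h S"
    using F(2) S J_le by (intro sum_mono) blast
  finally show ?thesis .
qed

text \<open>Lowering an even cap keeps the set critical: by the strict bound the lowered caps give a
  factor or criticality, and a factor would also serve the original caps. This reduces to odd caps,
  where the handshake lemma decides.\<close>

lemma critical_set_odd_card:
  assumes "finite U" "connected_set U" "\<And>v. v \<in> U \<Longrightarrow> h v > 0" "critical_set U (\<lambda>v. J (h v))"
  shows "odd (card U)"
  using assms
proof (induction "card {v \<in> U. even (h v)}" arbitrary: h rule: less_induct)
  case less
  note fin = less.prems(1) and conn = less.prems(2) and pos = less.prems(3) and crit = less.prems(4)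
  show ?case
  proof (cases "\<exists>v\<in>U. even (h v)")
    case True
    then obtain v where v: "v \<in> U" "even (h v)" by blast
    have hv: "h v > 0" using pos v(1) .
    define h' where "h' = h(v := h v - 1)"
    have sub: "J (h' u) \<subseteq> J (h u)" for u
      using lower_cap_subset[of h v, OF v(2) hv] by (simp only: h'_def)
    have pos': "h' u > 0" if "u \<in> U" for u
      using pos[OF that] v(2) by (cases "u = v") (auto simp: h'_def elim!: evenE)
    have "factorable U (\<lambda>u. J (h' u)) (\<lambda>_. 0) \<or> critical_set U (\<lambda>u. J (h' u))"
    proof (rule critical_comps_bound_imp_factorable_or_critical[OF fin conn pos'])
      show "card (critical_comps (U - S) (\<lambda>u. J (h' u))) \<le> sum h' S" if "S \<subseteq> U" "S \<noteq> {}" for S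
        unfolding h'_def
        using critical_comps_lower_cap[OF fin v(1) hv that(1)
            critical_set_imp_critical_comps_less[OF crit fin that]] .
    qed
    moreover have "\<not> factorable U (\<lambda>u. J (h' u)) (\<lambda>_. 0)"
    proof
      assume "factorable U (\<lambda>u. J (h' u)) (\<lambda>_. 0)"
      then have "factorable U (\<lambda>u. J (h u)) (\<lambda>_. 0)"
        using sub by (rule factorable_mono)
      then show False using crit by (simp add: critical_set_def)
    qed
    ultimately have "critical_set U (\<lambda>u. J (h' u))" by blast
    then show ?thesis
      using less.hyps[of h'] card_even_caps_lower[where h = h, OF fin v hv] fin conn pos' by (simp add: h'_def)
  next
    case False
    obtain x where x: "x \<in> U" using conn by (auto simp: connected_set_def)
    then obtain F where F: "F \<subseteq> induced_edges U"
        "\<And>v. v \<in> U \<Longrightarrow> degree_in F v + of_bool (v = x) \<in> J (h v)"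
      using crit by (auto simp: critical_set_def factorable_def)
    \<comment> \<open>With odd caps all degrees including the pendant unit are odd, while their sum
      is an even degree sum plus one.\<close>
    let ?g = "\<lambda>v. degree_in F v + of_bool (v = x)"
    have "{v \<in> U. odd (?g v)} = U" using F(2) False J_odd by auto
    then have "even (sum ?g U) \<longleftrightarrow> even (card U)" using even_sum_iff[OF fin, of ?g] by simp
    moreover have "sum ?g U = sum (degree_in F) U + 1"
      using fin x by (simp add: sum.distrib of_bool_def sum.delta)
    ultimately show ?thesis using sum_degree_in_even[OF F(1) fin] by auto
  qed
qed

subsection \<open>Factors and components of the whole graph\<close>

lemma edges_delete_verts: "edges (delete_verts G S) = induced_edges (verts G - S)"
  using ends_subset by (auto simp: delete_verts_def induced_edges_def)

text \<open>A class of \<open>reach\<close> is closed under edges, and following walks shows that a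
  nonempty closed part of it is everything.\<close>

lemma reach_class_in_comps:
  assumes v: "v \<in> verts G - S"
  shows "reach (delete_verts G S) `` {v} \<in> comps (verts G - S)"
proof -
  let ?W = "verts G - S" and ?r = "reach (delete_verts G S)"
  let ?A = "adj (delete_verts G S)"
  let ?R = "?r `` {v}"
  have R: "w \<in> ?R \<longleftrightarrow> w \<in> ?W \<and> (v, w) \<in> ?A\<^sup>*" for w
    using v by (auto simp: reach_def delete_verts_def)
  have ends_eq: "ends (delete_verts G S) = ends G" by (simp add: delete_verts_def)
  \<comment> \<open>For \<open>u = w\<close> the empty walk suffices; otherwise the edge is no loop
    and its ends are exactly \<open>u\<close> and \<open>w\<close>, as \<open>adj\<close>
    requires.\<close>
  have step: "(u, w) \<in> ?A\<^sup>*" if e: "e \<in> induced_edges ?W" "u \<in> ends G e" "w \<in> ends G e" for e u w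
  proof (cases "u = w")
    case False
    have "e \<in> edges G" using e by (simp add: induced_edges_def)
    then have "card (ends G e) = 2"
      using card_ends[of e] e(2,3) False by (metis card_1_singletonE singletonD)
    then obtain a b where "ends G e = {a, b}" by (auto simp: card_2_iff)
    then have "ends G e = {u, w}" using e False by auto
    then have "(u, w) \<in> ?A"
      using e(1) edges_delete_verts[of S] ends_eq by (auto simp: adj_def)
    then show ?thesis by blast
  qed simp
  have closed: "edge_closed ?W ?R"
    unfolding edge_closed_def
  proof (intro ballI impI subsetI)
    fix e w assume e: "e \<in> induced_edges ?W" "ends G e \<inter> ?R \<noteq> {}" and w: "w \<in> ends G e"
    then obtain u where u: "u \<in> ends G e" "u \<in> ?R" by blast
    have "(v, w) \<in> ?A\<^sup>*"
      using step[OF e(1) u(1) w] u(2) R[of u] by (meson rtrancl_trans)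
    moreover have "w \<in> ?W" using e(1) w unfolding induced_edges_def by blast
    ultimately show "w \<in> ?R" using R by blast
  qed
  have "D = ?R" if D: "D \<subseteq> ?R" "D \<noteq> {}" "edge_closed ?R D" for D
  proof
    show "?R \<subseteq> D"
    proof
      fix w assume w: "w \<in> ?R"
      obtain u where u: "u \<in> D" using D by blast
      interpret del: general_graph "delete_verts G S" by (rule general_graph_delete_verts)
      have "(u, w) \<in> ?r"
        using u D(1) w del.equiv_reach unfolding equiv_def sym_def trans_def by blast
      then have "(u, w) \<in> ?A\<^sup>*" by (simp add: reach_def)
      \<comment> \<open>Each edge of the walk starts in \<open>D\<close>, hence lies inside the
        class, and closedness of \<open>D\<close> puts its other end in \<open>D\<close>.\<close>
      then show "w \<in> D"
      proof (induction rule: rtrancl_induct)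
        case base
        show ?case by (rule u)
      next
        case (step y z)
        then obtain e where e: "e \<in> induced_edges ?W" "ends G e = {y, z}"
          using edges_delete_verts[of S] ends_eq by (auto simp: adj_def)
        have "ends G e \<subseteq> ?R"
          using closed e step.IH D(1) unfolding edge_closed_def by blast
        then have "e \<in> induced_edges ?R" using e(1) by (simp add: induced_edges_def)
        then show ?case using D(3) e(2) step.IH unfolding edge_closed_def by blast
      qed
    qed
  qed (rule D)
  moreover have "v \<in> ?R" using R v by blast
  ultimately have "connected_set ?R" unfolding connected_set_def by blast
  moreover have "?R \<subseteq> ?W" using R by blast
  ultimately show ?thesis using closed by (simp add: comps_def)
qed

lemma components_delete_verts: "components (delete_verts G S) = comps (verts G - S)"
proof
  have W: "verts (delete_verts G S) = verts G - S" by (simp add: delete_verts_def)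
  show "components (delete_verts G S) \<subseteq> comps (verts G - S)"
    using reach_class_in_comps by (auto simp: components_def W elim!: quotientE)
  show "comps (verts G - S) \<subseteq> components (delete_verts G S)"
  proof
    fix C assume C: "C \<in> comps (verts G - S)"
    obtain v where v: "v \<in> C" using comps_nonempty[OF C] by blast
    have vW: "v \<in> verts G - S" using v comps_subset[OF C] by blast
    then have "v \<in> reach (delete_verts G S) `` {v}" by (simp add: reach_def W)
    then have "C = reach (delete_verts G S) `` {v}"
      using comps_disjoint[OF C reach_class_in_comps[OF vW]] v by blast
    then show "C \<in> components (delete_verts G S)"
      using vW by (simp add: components_def W quotientI)
  qed
qed

lemma odd_comps_delete_verts: "odd_comps (delete_verts G S) = card (odd_components (verts G - S))"
  by (simp add: odd_comps_def odd_components_def components_delete_verts)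

lemma connected_graph_imp_connected_set:
  assumes "connected_graph G"
  shows "connected_set (verts G)"
proof -
  have G: "reach (delete_verts G {}) = reach G"
    by (simp add: delete_verts_def reach_def adj_def)
  obtain v where v: "v \<in> verts G" using assms by (auto simp: connected_graph_def)
  have "reach G `` {v} = verts G"
    using assms v by (auto simp: connected_graph_def reach_def)
  then show ?thesis
    using reach_class_in_comps[of v "{}"] v G comps_connected by simp
qed

lemma induced_edges_verts: "induced_edges (verts G) = edges G"
  using ends_subset by (auto simp: induced_edges_def)

lemma deg_eq_degree_in:
  assumes "\<And>e. e \<in> edges F \<Longrightarrow> ends F e = ends G e"
  shows "deg F v = degree_in (edges F) v"
proof -
  have "{e \<in> edges F. v \<in> ends F e} = {e \<in> edges F. v \<in> ends G e}"
    "{e \<in> edges F. ends F e = {v}} = {e \<in> edges F. ends G e = {v}}"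
    using assms by auto
  then show ?thesis by (simp add: deg_def degree_in_def)
qed

lemma has_factor_iff: "has_factor G H \<longleftrightarrow> factorable (verts G) H (\<lambda>_. 0)"
proof
  assume "has_factor G H"
  then obtain F where F: "edges F \<subseteq> edges G" "\<And>e. e \<in> edges F \<Longrightarrow> ends F e = ends G e"
      "\<And>v. v \<in> verts G \<Longrightarrow> deg F v \<in> H v"
    by (auto simp: has_factor_def is_factor_def spanning_subgraph_def)
  then show "factorable (verts G) H (\<lambda>_. 0)"
    using deg_eq_degree_in[of F] by (auto simp: factorable_def induced_edges_verts)
next
  assume "factorable (verts G) H (\<lambda>_. 0)"
  then obtain E where E: "E \<subseteq> edges G" "\<And>v. v \<in> verts G \<Longrightarrow> degree_in E v \<in> H v"
    by (auto simp: factorable_def induced_edges_verts)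
  define F where "F = \<lparr>verts = verts G, edges = E, ends = ends G\<rparr>"
  have "is_factor G H F"
    using E deg_eq_degree_in[of F] by (simp add: is_factor_def spanning_subgraph_def F_def)
  then show "has_factor G H" by (auto simp: has_factor_def)
qed

text \<open>\<open>None\<close> is the only edge without a counterpart in \<open>G\<close>; it is no
  loop and meets the old vertices in \<open>x\<close> alone.\<close>

lemma deg_pendant_subgraph:
  assumes F: "edges F \<subseteq> edges (add_pendant G x)" "None \<in> edges F"
      "\<And>e. e \<in> edges F \<Longrightarrow> ends F e = ends (add_pendant G x) e"
    and v: "v \<in> verts G"
  shows "deg F (Some v) = degree_in {e. Some e \<in> edges F} v + of_bool (v = x)"
proof -
  let ?E = "{e. Some e \<in> edges F}"
  have ends_Some: "ends F (Some e) = Some ` ends G e" if "e \<in> ?E" for e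
    using F(3)[of "Some e"] that by (simp add: add_pendant_def)
  have ends_None: "ends F None = {Some x, None}"
    using F(3)[OF F(2)] by (simp add: add_pendant_def)
  have "?E \<subseteq> edges G" using F(1) by (auto simp: add_pendant_def)
  then have fin: "finite ?E" using finite_edges finite_subset by blast
  have "{e \<in> edges F. Some v \<in> ends F e}
      = Some ` {e \<in> ?E. v \<in> ends G e} \<union> (if v = x then {None} else {})"
    (is "?L = ?R")
  proof (rule set_eqI)
    show "e \<in> ?L \<longleftrightarrow> e \<in> ?R" for e
      using ends_Some ends_None F(2) by (cases e) auto
  qed
  then have "card {e \<in> edges F. Some v \<in> ends F e} = card {e \<in> ?E. v \<in> ends G e} + of_bool (v = x)"
    using fin by (simp add: card_image)
  moreover have "{e \<in> edges F. ends F e = {Some v}} = Some ` {e \<in> ?E. ends G e = {v}}"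
    (is "?L = ?R")
  proof (rule set_eqI)
    fix e
    have "Some ` A = {Some v} \<longleftrightarrow> A = {v}" for A :: "'v set"
      using inj_image_eq_iff[of Some A "{v}"] by simp
    then show "e \<in> ?L \<longleftrightarrow> e \<in> ?R"
      using ends_Some ends_None F(2) by (cases e) (auto simp: image_iff)
  qed
  ultimately show ?thesis by (simp add: deg_def degree_in_def card_image)
qed

lemma has_factor_add_pendant_iff:
  "has_factor (add_pendant G x) (extend_pendant H) \<longleftrightarrow>
    factorable (verts G) H (\<lambda>v. of_bool (v = x))"
proof
  assume "has_factor (add_pendant G x) (extend_pendant H)"
  then obtain F where F: "edges F \<subseteq> edges (add_pendant G x)"
      "\<And>e. e \<in> edges F \<Longrightarrow> ends F e = ends (add_pendant G x) e"
      "\<And>v. v \<in> verts (add_pendant G x) \<Longrightarrow> deg F v \<in> extend_pendant H v"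
    by (auto simp: has_factor_def is_factor_def spanning_subgraph_def)
  \<comment> \<open>The new vertex needs degree one and the pendant edge is the only edge at
    it.\<close>
  have "None \<in> edges F"
  proof (rule ccontr)
    assume "None \<notin> edges F"
    then have "None \<notin> ends F e" if "e \<in> edges F" for e
      using that F(2)[OF that] by (cases e) (auto simp: add_pendant_def)
    then have "{e \<in> edges F. None \<in> ends F e} = {}" "{e \<in> edges F. ends F e = {None}} = {}"
      by auto
    then have "deg F None = 0" unfolding deg_def by (simp only: card.empty)
    then show False using F(3)[of None] by (simp add: add_pendant_def extend_pendant_def)
  qed
  then have "degree_in {e. Some e \<in> edges F} v + of_bool (v = x) \<in> H v" if "v \<in> verts G" for v
    using deg_pendant_subgraph[of F x v] F(1,2) F(3)[of "Some v"] that
    by (simp add: add_pendant_def extend_pendant_def)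
  moreover have "{e. Some e \<in> edges F} \<subseteq> edges G" using F(1) by (auto simp: add_pendant_def)
  ultimately show "factorable (verts G) H (\<lambda>v. of_bool (v = x))"
    unfolding factorable_def induced_edges_verts by blast
next
  assume "factorable (verts G) H (\<lambda>v. of_bool (v = x))"
  then obtain E where E: "E \<subseteq> edges G"
      "\<And>v. v \<in> verts G \<Longrightarrow> degree_in E v + of_bool (v = x) \<in> H v"
    unfolding factorable_def induced_edges_verts by blast
  define F where "F = \<lparr>verts = verts (add_pendant G x), edges = insert None (Some ` E),
    ends = ends (add_pendant G x)\<rparr>"
  have sub: "edges F \<subseteq> edges (add_pendant G x)"
    using E(1) by (auto simp: F_def add_pendant_def)
  have "deg F u \<in> extend_pendant H u" if u: "u \<in> verts (add_pendant G x)" for u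
  proof (cases u)
    case None
    have "None \<notin> ends F (Some e)" "ends F None = {Some x, None}" "None \<in> edges F" for e
      by (auto simp: F_def add_pendant_def)
    then have "e \<in> edges F \<and> None \<in> ends F e \<longleftrightarrow> e = None"
      "\<not> (e \<in> edges F \<and> ends F e = {None})" for e
      by (cases e; fastforce)+
    then have "{e \<in> edges F. None \<in> ends F e} = {None}" "{e \<in> edges F. ends F e = {None}} = {}"
      by blast+
    then have "deg F None = 1" by (simp only: deg_def) simp
    then show ?thesis using None by (simp add: extend_pendant_def)
  next
    case (Some v)
    then have v: "v \<in> verts G" using u by (auto simp: add_pendant_def)
    have "{e. Some e \<in> edges F} = E" by (auto simp: F_def)
    then have "deg F (Some v) = degree_in E v + of_bool (v = x)"
      using deg_pendant_subgraph[of F x v, OF sub] v by (simp add: F_def)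
    then show ?thesis using Some E(2)[OF v] by (simp add: extend_pendant_def)
  qed
  then have "is_factor (add_pendant G x) (extend_pendant H) F"
    using sub by (simp add: is_factor_def spanning_subgraph_def F_def)
  then show "has_factor (add_pendant G x) (extend_pendant H)" by (auto simp: has_factor_def)
qed

lemma critical_iff: "critical G H \<longleftrightarrow> critical_set (verts G) H"
  by (simp add: critical_def critical_set_def has_factor_iff has_factor_add_pendant_iff)

section \<open>The two implications of the theorem\<close>

text \<open>Critical components have odd order by \<open>critical_set_odd_card\<close>, so a bound
  on the odd components also bounds the critical ones.\<close>

lemma odd_components_bound_imp_factor:
  assumes conn: "connected_set U" and U: "finite U"
    and h: "\<And>v. v \<in> U \<Longrightarrow> h v > 0"
    and bound: "\<And>S. S \<subseteq> U \<Longrightarrow> S \<noteq> {} \<Longrightarrow> card (odd_components (U - S)) \<le> sum h S"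
  shows "factorable U (\<lambda>v. J (h v)) (\<lambda>_. 0) \<or> critical_set U (\<lambda>v. J (h v))"
proof (rule critical_comps_bound_imp_factorable_or_critical[OF U conn h])
  fix S assume S: "S \<subseteq> U" "S \<noteq> {}"
  have "critical_comps (U - S) (\<lambda>v. J (h v)) \<subseteq> odd_components (U - S)"
  proof
    fix C assume C: "C \<in> critical_comps (U - S) (\<lambda>v. J (h v))"
    then have comp: "C \<in> comps (U - S)" by (simp add: critical_comps_def)
    have CU: "C \<subseteq> U" using comps_subset[OF comp] by blast
    have "odd (card C)"
    proof (rule critical_set_odd_card)
      show "finite C" using CU U finite_subset by blast
      show "connected_set C" using comps_connected[OF comp] .
      show "h v > 0" if "v \<in> C" for v using that CU h by blast
      show "critical_set C (\<lambda>v. J (h v))" using C by (simp add: critical_comps_def)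
    qed
    then show "C \<in> odd_components (U - S)" using comp by (simp add: odd_components_def)
  qed
  then have "card (critical_comps (U - S) (\<lambda>v. J (h v))) \<le> card (odd_components (U - S))"
    using U finite_comps[of "U - S"] by (intro card_mono) (auto simp: odd_components_def)
  then show "card (critical_comps (U - S) (\<lambda>v. J (h v))) \<le> sum h S"
    using bound[OF S] by linarith
qed

text \<open>An odd component cannot have all degrees odd by itself, so it must send an edge to
  \<open>S\<close>, where degrees and shift together are at most \<open>f\<close>.\<close>

lemma factorable_imp_odd_components_le:
  assumes U: "finite U" "S \<subseteq> U"
    and odd_H: "\<And>v m. v \<in> U - S \<Longrightarrow> m \<in> H v \<Longrightarrow> odd m"
    and le_H: "\<And>v m. v \<in> S \<Longrightarrow> m \<in> H v \<Longrightarrow> m \<le> f v"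
    and b: "\<And>v. v \<in> U - S \<Longrightarrow> b v = 0"
    and fac: "factorable U H b"
  shows "card (odd_components (U - S)) + sum b S \<le> sum f S"
proof -
  obtain F where F: "F \<subseteq> induced_edges U" "\<And>v. v \<in> U \<Longrightarrow> degree_in F v + b v \<in> H v"
    using fac by (auto simp: factorable_def)
  have "card (odd_components (U - S)) \<le> sum (degree_in F) S"
  proof (rule card_comps_le_sum_degree_in[OF F(1) U(2,1)])
    show "odd_components (U - S) \<subseteq> comps (U - S)" by (auto simp: odd_components_def)
    fix C F' assume C: "C \<in> odd_components (U - S)"
      and F': "F' \<subseteq> induced_edges C" "\<And>v. v \<in> C \<Longrightarrow> degree_in F' v = degree_in F v"
    have CU: "C \<subseteq> U - S" using C comps_subset unfolding odd_components_def by blast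
    have "even (card C)"
    proof (rule odd_degrees_even_order[OF F'(1)])
      show "finite C" using CU U by (meson finite_Diff finite_subset)
      fix v assume v: "v \<in> C"
      then have "v \<in> U - S" using CU by blast
      then show "odd (degree_in F' v)" using F(2)[of v] b[of v] odd_H[of v] F'(2)[OF v] by simp
    qed
    then show False using C by (simp add: odd_components_def)
  qed
  moreover have "(\<Sum>v\<in>S. degree_in F v + b v) \<le> sum f S"
    using F(2) U le_H by (intro sum_mono) blast
  ultimately show ?thesis by (simp add: sum.distrib)
qed

end

text \<open>Puts every admissible \<open>H\<close> into the form \<open>J\<close> of a cap, the cap
  being \<open>f v\<close> or \<open>f v + 1\<close>.\<close>

lemma J_plus_eq: "J_plus n = (if odd n then J n else J (n + 1))"
proof (cases "odd n")
  case True
  have "odd m \<and> m \<le> n + 1 \<longleftrightarrow> odd m \<and> m \<le> n" for m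
    using True by (metis Suc_eq_plus1 even_Suc le_Suc_eq)
  then show ?thesis using True by (simp add: J_plus_def J_def)
qed (simp add: J_plus_def J_def)

theorem theorem2p4:
  fixes G :: "('v, 'e) pre_graph" and f :: "'v \<Rightarrow> nat"
  assumes "general_graph G"
    and "connected_graph G"
    and "odd (card (verts G))"
    and "\<And>v. v \<in> verts G \<Longrightarrow> f v > 0"
  shows "(\<forall>S. S \<subseteq> verts G \<and> S \<noteq> {} \<longrightarrow> odd_comps (delete_verts G S) \<le> (\<Sum>v\<in>S. f v))
    \<longleftrightarrow> (\<forall>H :: 'v \<Rightarrow> nat set.
          (\<forall>v \<in> verts G. H v \<in> {J (f v), J_plus (f v)}) \<longrightarrow> has_factor G H \<or> critical G H)"
proof -
  interpret general_graph G by (rule assms(1))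
  have conn: "connected_set (verts G)"
    using connected_graph_imp_connected_set assms(2) .
  show ?thesis
  proof (intro iffI allI impI)
    fix H :: "'v \<Rightarrow> nat set"
    assume bound: "\<forall>S. S \<subseteq> verts G \<and> S \<noteq> {} \<longrightarrow> odd_comps (delete_verts G S) \<le> (\<Sum>v\<in>S. f v)"
      and H: "\<forall>v \<in> verts G. H v \<in> {J (f v), J_plus (f v)}"
    \<comment> \<open>These caps dominate \<open>f\<close>, so the assumed bound passes on to
      them.\<close>
    define h where "h v = (if H v = J (f v) then f v else f v + 1)" for v
    have H_eq: "H v = J (h v)" if "v \<in> verts G" for v
      using H that by (auto simp: h_def J_plus_eq split: if_splits)
    have "factorable (verts G) (\<lambda>v. J (h v)) (\<lambda>_. 0) \<or> critical_set (verts G) (\<lambda>v. J (h v))"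
    proof (rule odd_components_bound_imp_factor[OF conn finite_verts])
      show "h v > 0" if "v \<in> verts G" for v using assms(4)[OF that] by (simp add: h_def)
      show "card (odd_components (verts G - S)) \<le> sum h S" if "S \<subseteq> verts G" "S \<noteq> {}" for S
      proof -
        have "card (odd_components (verts G - S)) \<le> sum f S"
          using bound that odd_comps_delete_verts by simp
        also have "\<dots> \<le> sum h S" by (intro sum_mono) (simp add: h_def)
        finally show ?thesis .
      qed
    qed
    moreover have "critical_set (verts G) H \<longleftrightarrow> critical_set (verts G) (\<lambda>v. J (h v))"
      using H_eq by (rule critical_set_cong)
    moreover have "factorable (verts G) H (\<lambda>_. 0) \<longleftrightarrow> factorable (verts G) (\<lambda>v. J (h v)) (\<lambda>_. 0)"
      using H_eq by (intro factorable_cong) auto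
    ultimately show "has_factor G H \<or> critical G H"
      by (simp add: has_factor_iff critical_iff)
  next
    fix S
    assume *: "\<forall>H :: 'v \<Rightarrow> nat set. (\<forall>v \<in> verts G. H v \<in> {J (f v), J_plus (f v)}) \<longrightarrow>
        has_factor G H \<or> critical G H"
      and "S \<subseteq> verts G \<and> S \<noteq> {}"
    then have S: "S \<subseteq> verts G" and "S \<noteq> {}" by auto
    then obtain x where x: "x \<in> S" by blast
    \<comment> \<open>Outside \<open>S\<close> only odd values are allowed, which forces edges out
      of the odd components; on \<open>S\<close> the set \<open>J\<close> keeps the degrees at most
      \<open>f v\<close>, whereas \<open>J_plus\<close> could reach \<open>f v + 1\<close>.\<close>
    define H where "H v = (if v \<in> S then J (f v) else J_plus (f v))" for v
    have "has_factor G H \<or> critical G H" using * by (simp add: H_def)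
    \<comment> \<open>In the critical case the pendant edge is placed at \<open>x\<close> in
      \<open>S\<close>, so the shift vanishes outside \<open>S\<close>.\<close>
    then obtain b where b: "factorable (verts G) H b" "\<And>v. v \<in> verts G - S \<Longrightarrow> b v = 0"
    proof
      assume "has_factor G H"
      then show ?thesis using that[of "\<lambda>_. 0"] by (simp add: has_factor_iff)
    next
      assume "critical G H"
      then show ?thesis
        using that[of "\<lambda>v. of_bool (v = x)"] x S by (auto simp: critical_iff critical_set_def)
    qed
    have "card (odd_components (verts G - S)) + sum b S \<le> sum f S"
    proof (rule factorable_imp_odd_components_le[OF finite_verts S _ _ b(2,1)])
      show "odd m" if "v \<in> verts G - S" "m \<in> H v" for v m
        using that by (simp add: H_def J_plus_def)
      show "m \<le> f v" if "v \<in> S" "m \<in> H v" for v m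
        using that J_le by (simp add: H_def)
    qed
    then show "odd_comps (delete_verts G S) \<le> sum f S"
      by (simp add: odd_comps_delete_verts)
  qed
qed

end
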